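(* There exists an absolute constant $c>0$ such that the following holds. Let $m,n$ be positive integers and let $M_1,\ldots,M_n$ be independent $m\times m$ positive semidefinite real symmetric (resp. positive semidefinite self-adjoint) random matrices. Suppose that $\alpha\ge 0$ and $0<\beta\le 1$ are real numbers such that $$\sum_{i=1}^n \mathbb{P}\left(x^* M_i x>\alpha\right)\ge n\beta$$ for every unit column vector $x$ in $\mathbb{R}^m$ (resp. in $\mathbb{C}^m$). Suppose that $$n\ge \frac{c\,m}{\beta}\log\frac{2}{\beta}.$$ Then $$\mathbb{P}\left(\sigma_m\left(\frac1n\sum_{i=1}^n M_i\right)\le \frac{\alpha\beta}{2}\right)\le \exp\left(-\frac{n\beta}{c}\right).$$
   Context: For an $m\times m$ matrix $M$, $\sigma_1(M)\ge\cdots\ge\sigma_m(M)$ denote its singular values, so $\sigma_m(M)$ is the minimum singular value. $x^*$ is the conjugate transpose. $\log$ is the natural logarithm. *)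

theory Defs
  imports "HOL-Probability.Probability" "Jordan_Normal_Form.Schur_Decomposition"
begin

(* Everything is stated over a scalar field 'a that is later instantiated with real and with
   complex; on real the conjugation of Jordan_Normal_Form is the identity, so mat_adjoint is
   the transpose.  Matrices with an explicit carrier are used, rather than matrices indexed by
   a finite type, because the dimension m is quantified inside the scope of the constant c.

   The order on complex is the partial one (y <= z iff Re y <= Re z and Im y = Im z), so that
   "0 <= z" means that z is real and nonnegative. *)

definition psd_mat :: "nat \<Rightarrow> 'a::conjugatable_ordered_field mat \<Rightarrow> bool" where
  "psd_mat m A \<longleftrightarrow> A \<in> carrier_mat m m \<and> mat_adjoint A = A \<and>
     (\<forall>x\<in>carrier_vec m. 0 \<le> (A *\<^sub>v x) \<bullet>c x)"

(* The singular values of a square matrix A, in decreasing order and with multiplicity, are the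
   square roots of the eigenvalues of A* A.  These eigenvalues are real and nonnegative and the
   characteristic polynomial splits (also over the reals), so the list has length dim_col A,
   and norm merely turns a nonnegative eigenvalue of type 'a into a real number. *)

definition singular_values :: "'a::{conjugatable_ordered_field, real_normed_field} mat \<Rightarrow> real list" where
  "singular_values A =
     rev (sorted_list_of_multiset
       (image_mset (\<lambda>z. sqrt (norm z)) (proots (char_poly (mat_adjoint A * A)))))"

definition sigma_val :: "nat \<Rightarrow> 'a::{conjugatable_ordered_field, real_normed_field} mat \<Rightarrow> real" where
  "sigma_val i A = singular_values A ! (i - 1)"

(* The Borel sigma-algebra on m x m matrices, i.e. the one generated by the entries. *)

definition borel_mat :: "nat \<Rightarrow> 'a::{conjugatable_ordered_field, real_normed_field} mat measure" where
  "borel_mat m = vimage_algebra (carrier_mat m m)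
     (\<lambda>A. \<lambda>p\<in>{..<m} \<times> {..<m}. A $$ p) (\<Pi>\<^sub>M p\<in>{..<m} \<times> {..<m}. borel)"

definition mean_mat :: "nat \<Rightarrow> nat \<Rightarrow> (nat \<Rightarrow> 'a::field mat) \<Rightarrow> 'a mat" where
  "mean_mat m n A = Matrix.mat m m (\<lambda>p. (1 / of_nat n) * (\<Sum>i=1..n. A i $$ p))"

(* tail_bound_over W F c: the assertion for the constant c, for random matrices over the scalar
   field F that are defined on a probability space whose points have type W.
   The scalar (M x) . conjugate x is x* M x. *)

definition tail_bound_over ::
    "'w itself \<Rightarrow> 'a::{conjugatable_ordered_field, real_normed_field} itself \<Rightarrow> real \<Rightarrow> bool" where
  "tail_bound_over _ _ c \<longleftrightarrow>
    (\<forall>(P :: 'w measure) m n (M :: nat \<Rightarrow> 'w \<Rightarrow> 'a mat) \<alpha> \<beta>.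
       prob_space P \<longrightarrow> 0 < m \<longrightarrow> 0 < n \<longrightarrow>
       prob_space.indep_vars P (\<lambda>_. borel_mat m) M {1..n} \<longrightarrow>
       (\<forall>i\<in>{1..n}. \<forall>\<omega>\<in>space P. psd_mat m (M i \<omega>)) \<longrightarrow>
       0 \<le> \<alpha> \<longrightarrow> 0 < \<beta> \<longrightarrow> \<beta> \<le> 1 \<longrightarrow>
       (\<forall>x\<in>carrier_vec m. x \<bullet>c x = 1 \<longrightarrow>
          (\<Sum>i=1..n. measure P {\<omega> \<in> space P. (M i \<omega> *\<^sub>v x) \<bullet>c x > of_real \<alpha>})
            \<ge> real n * \<beta>) \<longrightarrow>
       real n \<ge> c * real m / \<beta> * ln (2 / \<beta>) \<longrightarrow>
       measure P {\<omega> \<in> space P. sigma_val m (mean_mat m n (\<lambda>i. M i \<omega>)) \<le> \<alpha> * \<beta> / 2}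
         \<le> exp (- (real n * \<beta> / c)))"

definition tail_bound :: "'w itself \<Rightarrow> real \<Rightarrow> bool" where
  "tail_bound W c \<longleftrightarrow>
     tail_bound_over W TYPE(real) c \<and> tail_bound_over W TYPE(complex) c"

(* HOL cannot quantify over the type 'w of sample points underneath "there is a c", and in
   "EX c > 0. tail_bound TYPE('w) c" the constant could formally depend on 'w.  An absolute
   constant is therefore expressed in two steps: one exists for sample points of the fixed type
   nat => complex mat, which can carry the joint law of any sequence of random matrices, and
   every constant valid there is valid for sample points of an arbitrary type 'w. *)

abbreviation (input) canonical_sample :: "(nat \<Rightarrow> complex mat) itself" where
  "canonical_sample \<equiv> TYPE(nat \<Rightarrow> complex mat)"

end

theory Submission
  imports Defs "HOL-Library.Function_Algebras"
begin

text \<open>Let \<open>C\<^sub>i = {y. y\<^sup>* M\<^sub>i y \<le> a}\<close> with \<open>a = (7/8)\<^sup>2 \<alpha>\<close>. Since \<open>M\<^sub>i\<close> is positive semidefinite, \<open>C\<^sub>i\<close> is a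
convex (possibly degenerate or unbounded) solid ellipsoid centred at the origin. If the smallest singular value of the mean is at
most \<open>\<alpha>\<beta>/2\<close>, then some unit vector \<open>w\<close> satisfies \<open>\<Sum> w\<^sup>* M\<^sub>i w \<le> n\<alpha>\<beta>/2\<close>
(\<open>unit_vector_sigma_val\<close>), so \<open>w\<close> lies in all but at most \<open>(2/3)n\<beta>\<close> of the \<open>C\<^sub>i\<close>. For a vector chosen in
advance this would be exponentially unlikely, since by hypothesis
it is expected to lie outside of at least \<open>n\<beta>\<close> of them. The difficulty is that \<open>w\<close> depends on all the
matrices, and that their entries are not bounded in any way, so that \<open>w\<close> cannot be moved to a nearby fixed vector.

The solution is to compress \<open>w\<close> into few matrices by means of Helly's theorem. Take a point \<open>u\<close> of a fixed
\<open>1/16\<close>-net of the unit sphere near \<open>w\<close>, let \<open>B\<close> be the set of the \<open>i\<close> with \<open>w \<in> C\<^sub>i\<close>, and let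
\<open>y\<close> be the point of \<open>\<Inter>i\<in>B. C\<^sub>i\<close> closest to \<open>u\<close>. The open ball around \<open>u\<close> of radius \<open>|y - u|\<close> does
not meet this intersection, so by Helly's theorem in the real dimension \<open>d\<close> of the space it does not meet \<open>\<Inter>i\<in>I. C\<^sub>i\<close> for
some \<open>I \<subseteq> B\<close> with at most \<open>d + 1\<close> elements (\<open>feas_dist_compression\<close>). By uniqueness of the closest point, \<open>y\<close> is a
function of \<open>u\<close> and of the matrices with index in \<open>I\<close> alone. Moreover \<open>|y| \<ge> 7/8\<close>, so the normalized
\<open>y\<close> has form at most \<open>\<alpha>\<close> for all \<open>i \<in> B\<close>.

For given \<open>u\<close> and \<open>I\<close>, the matrices outside of \<open>I\<close> are independent of \<open>y\<close>, and a Chernoff bound shows that it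
is exponentially unlikely in \<open>n\<beta>\<close> that \<open>y\<close> lies in all but at most \<open>(2/3)n\<beta>\<close> of the corresponding ellipsoids
(\<open>prob_few_increases\<close>). A union bound over the \<open>exp(O(m))\<close> net points and over the sets \<open>I\<close>, of which there are
at most \<open>exp(n\<beta>/200 + O(m log(2/\<beta>)))\<close>, finishes the argument: this is where \<open>n\<close> has to be large
(\<open>union_bound_arith\<close>, \<open>uniform_lower_tail\<close>).

The point \<open>y\<close> never occurs in an event. Only its distance \<open>D\<^sub>I\<close> from \<open>u\<close> does, which is easily seen to be
measurable: \<open>y \<in> C\<^sub>j\<close> holds if and only if \<open>D\<close> does not increase when \<open>j\<close> is added to \<open>I\<close>.

The real and the complex case are instances of one locale, in which a vector over the scalar field is described by
its real coordinates. A constant that works for the canonical sample type works for every other one,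
because a random sequence of matrices can be pushed forward to the space of sequences of complex matrices
(\<open>tail_bound_over_pullback\<close>).\<close>

section \<open>Helly's theorem, counting subsets, and a net of the sphere\<close>

text \<open>The dimension is quantified inside the scope of the absolute constant, so it cannot be a type. Vectors of all
dimensions therefore live in the single type \<^typ>\<open>nat \<Rightarrow> real\<close>, and the pointwise vector space structure
makes the notions of convexity, span and affine dependence available there.\<close>

instantiation "fun" :: (type, real_vector) real_vector
begin

definition "scaleR r f = (\<lambda>x. r *\<^sub>R f x)"

instance
  by standard (simp_all add: scaleR_fun_def fun_eq_iff scaleR_add_right scaleR_add_left)

end

lemma scaleR_fun_apply [simp]: "(r *\<^sub>R f) x = r *\<^sub>R f x"
  by (simp add: scaleR_fun_def)

lemma sum_fun_apply: "(\<Sum>i\<in>I. f i) x = (\<Sum>i\<in>I. f i x)"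
  for f :: "'i \<Rightarrow> 'a \<Rightarrow> 'b::comm_monoid_add"
  by (induction I rule: infinite_finite_induct) auto

text \<open>The bound of Euclidean spaces, with the dimension replaced by the size of a spanning set: differences with
a fixed point of \<open>S\<close> are more than \<open>card B\<close> vectors in the span of \<open>B\<close>.\<close>

lemma affine_dependent_biggerset_span:
  fixes S B :: "'v::real_vector set"
  assumes "finite B" "finite S" "S \<subseteq> span B" "card S \<ge> card B + 2"
  shows "affine_dependent S"
proof -
  obtain a where a: "a \<in> S" using assms by (cases "S = {}") auto
  have inj: "inj_on (\<lambda>x. x - a) (S - {a})" by (auto simp: inj_on_def)
  have c: "card ((\<lambda>x. x - a) ` (S - {a})) > card B"
    using assms a by (simp add: card_image[OF inj])
  have sub: "(\<lambda>x. x - a) ` (S - {a}) \<subseteq> span B"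
    using assms(3) a by (auto intro!: span_diff)
  have "dependent ((\<lambda>x. x - a) ` (S - {a}))"
    using independent_span_bound[OF assms(1) _ sub] c by fastforce
  then have "dependent {x - a | x. x \<in> S - {a}}"
    by (simp only: setcompr_eq_image Collect_mem_eq)
  then have "affine_dependent (insert a (S - {a}))"
    by (rule dependent_imp_affine_dependent) simp
  then show ?thesis using a by (simp add: insert_absorb)
qed

text \<open>The induction behind Helly's theorem: if any \<open>card J - 1\<close> of the sets have a common point and
\<open>card J \<ge> card B + 2\<close>, a Radon partition of these points yields a point common to all. The set \<open>W\<close> belongs to every subfamily; it carries the restriction to
a finite-dimensional space, and it does not count towards the size of the subfamily.\<close>

lemma Helly_span:
  fixes C :: "'i \<Rightarrow> 'v::real_vector set"
  assumes B: "finite B" and J: "finite J"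
    and cv: "\<And>i. i \<in> J \<Longrightarrow> convex (C i)" and W: "convex W" "W \<subseteq> span B"
    and I: "\<And>I. I \<subseteq> J \<Longrightarrow> card I \<le> card B + 1 \<Longrightarrow> \<exists>y\<in>W. \<forall>i\<in>I. y \<in> C i"
  shows "\<exists>y\<in>W. \<forall>i\<in>J. y \<in> C i"
  using J cv I
proof (induction "card J" arbitrary: J rule: less_induct)
  case (less J)
  show ?case
  proof (cases "card J \<le> card B + 1")
    case True then show ?thesis using less.prems(3)[of J] by blast
  next
    case False
    have "\<exists>y\<in>W. \<forall>i\<in>J - {j}. y \<in> C i" if "j \<in> J" for j
    proof (rule less.hyps)
      show "card (J - {j}) < card J" using that less.prems(1) by (rule card_Diff1_less[rotated])
      show "finite (J - {j})" using less.prems(1) by simp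
      show "convex (C i)" if "i \<in> J - {j}" for i using that less.prems(2) by simp
      show "\<exists>y\<in>W. \<forall>i\<in>I. y \<in> C i" if "I \<subseteq> J - {j}" "card I \<le> card B + 1" for I
        using that less.prems(3)[of I] by blast
    qed
    then obtain X where X: "\<And>j. j \<in> J \<Longrightarrow> X j \<in> W" "\<And>j i. j \<in> J \<Longrightarrow> i \<in> J \<Longrightarrow> i \<noteq> j \<Longrightarrow> X j \<in> C i"
      by (metis insertE insert_Diff)
    show ?thesis
    proof (cases "inj_on X J")
      case False
      then obtain i j where ij: "i \<in> J" "j \<in> J" "X i = X j" "i \<noteq> j" unfolding inj_on_def by auto
      have "\<forall>k\<in>J. X i \<in> C k" using ij X by metis
      then show ?thesis using ij X by blast
    next
      case inj: True
      have "affine_dependent (X ` J)"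
        using False W X(1) less.prems(1)
        by (intro affine_dependent_biggerset_span[OF B]) (auto simp: card_image[OF inj])
      then obtain M P where MP: "M \<inter> P = {}" "M \<union> P = X ` J" "convex hull M \<inter> convex hull P \<noteq> {}"
        using Radon_partition[of "X ` J"] less.prems(1) by auto
      then obtain y where y: "y \<in> convex hull M" "y \<in> convex hull P" by auto
      have *: "y \<in> C i" if i: "i \<in> J" for i
      proof -
        have "M \<subseteq> C i \<or> P \<subseteq> C i"
        proof (cases "X i \<in> M")
          case True
          have "P \<subseteq> C i"
          proof
            fix p assume p: "p \<in> P"
            then obtain j where j: "j \<in> J" "p = X j" using MP by blast
            with p True MP(1) have "i \<noteq> j" by auto
            with j i X show "p \<in> C i" by auto
          qed
          then show ?thesis ..
        next
          case False
          have "M \<subseteq> C i"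
          proof
            fix p assume p: "p \<in> M"
            then obtain j where j: "j \<in> J" "p = X j" using MP by blast
            with p False have "i \<noteq> j" by auto
            with j i X show "p \<in> C i" by auto
          qed
          then show ?thesis ..
        qed
        then show ?thesis using y less.prems(2)[OF i] by (metis hull_minimal subsetD)
      qed
      have "X ` J \<subseteq> W" using X(1) by blast
      then have "M \<subseteq> W" using MP(2) by blast
      then have "y \<in> W" using y W by (metis hull_minimal subsetD)
      with * show ?thesis by blast
    qed
  qed
qed

text \<open>Weighting a subset \<open>I\<close> by \<open>x ^ card I\<close> makes the total weight \<open>(1 + x) ^ card K\<close>, while each counted set
has weight at least \<open>x ^ k\<close>. The free parameter \<open>x\<close> lets the first term of the exponent be as small a multiple
of \<open>card K\<close> as desired, at a merely logarithmic cost in the second.\<close>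

lemma card_bounded_subsets_le:
  fixes x :: real
  assumes "finite K" "0 < x" "x \<le> 1"
  shows "real (card {I. I \<subseteq> K \<and> card I \<le> k}) \<le> exp (real (card K) * x + real k * ln (1 / x))"
proof -
  have fin: "finite {I. I \<subseteq> K \<and> card I \<le> k}" using assms by auto
  have "real (card {I. I \<subseteq> K \<and> card I \<le> k}) * x ^ k = (\<Sum>I | I \<subseteq> K \<and> card I \<le> k. x ^ k)"
    by simp
  also have "\<dots> \<le> (\<Sum>I | I \<subseteq> K \<and> card I \<le> k. x ^ card I)"
    using assms by (intro sum_mono power_decreasing) auto
  also have "\<dots> \<le> (\<Sum>I\<in>Pow K. x ^ card I)"
    using assms by (intro sum_mono2) auto
  also have "\<dots> = (\<Sum>I\<in>Pow K. (\<Prod>i\<in>I. x) * (\<Prod>i\<in>K - I. 1))"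
    by (intro sum.cong) auto
  also have "\<dots> = (\<Prod>i\<in>K. x + 1)"
    using prod_add[OF assms(1), of "\<lambda>_. x" "\<lambda>_. 1"] by simp
  also have "\<dots> = (1 + x) ^ card K" by (simp add: add.commute)
  also have "\<dots> \<le> exp x ^ card K" using assms by (intro power_mono) (auto simp: exp_ge_add_one_self)
  also have "\<dots> = exp (real (card K) * x)" by (simp add: exp_of_nat_mult)
  finally have "real (card {I. I \<subseteq> K \<and> card I \<le> k}) \<le> exp (real (card K) * x) / x ^ k"
    using assms by (simp add: field_simps)
  also have "\<dots> = exp (real (card K) * x + real k * ln (1 / x))"
    using assms by (simp add: exp_add exp_of_nat_mult power_divide exp_minus ln_div exp_diff divide_inverse flip: power_inverse)
  finally show ?thesis .
qed

text \<open>The space \<open>\<real>\<^sup>d\<close> inside \<^typ>\<open>nat \<Rightarrow> real\<close>.\<close>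

definition coord_space :: "nat \<Rightarrow> (nat \<Rightarrow> real) set" where
  "coord_space d = {y. \<forall>i\<ge>d. y i = 0}"

abbreviation coord_norm :: "nat \<Rightarrow> (nat \<Rightarrow> real) \<Rightarrow> real" where
  "coord_norm d y \<equiv> L2_set y {..<d}"

lemma coord_space_span:
  obtains B where "finite B" "card B \<le> d" "coord_space d \<subseteq> span B"
proof
  define e :: "nat \<Rightarrow> nat \<Rightarrow> real" where "e i = (\<lambda>j. if j = i then 1 else 0)" for i
  show "finite (e ` {..<d})" by simp
  show "card (e ` {..<d}) \<le> d" using card_image_le[of "{..<d}" e] by simp
  show "coord_space d \<subseteq> span (e ` {..<d})"
  proof
    fix y assume "y \<in> coord_space d"
    then have "y = (\<Sum>i<d. y i *\<^sub>R e i)"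
      by (auto simp: fun_eq_iff sum_fun_apply e_def coord_space_def not_less if_distrib[of "(*) _"] cong: if_cong)
    also have "\<dots> \<in> span (e ` {..<d})" by (intro span_sum span_scale span_base) auto
    finally show "y \<in> span (e ` {..<d})" .
  qed
qed

text \<open>Again by weights: \<open>2 ^ - (\<Sum>i. \<bar>k i\<bar>)\<close> is at least \<open>2 ^ - L\<close> on the set counted and sums
to at most \<open>3 ^ d\<close> over the whole lattice, since \<open>(\<Sum>j::int. 2 ^ - \<bar>j\<bar>) = 3\<close>.\<close>

lemma card_integer_cross_polytope_le:
  fixes L d :: nat
  shows "real (card {k \<in> {..<d} \<rightarrow>\<^sub>E {- int L..int L}. (\<Sum>i<d. \<bar>k i\<bar>) \<le> int L}) \<le> 3 ^ d * 2 ^ L"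
proof -
  let ?S = "{k \<in> {..<d} \<rightarrow>\<^sub>E {- int L..int L}. (\<Sum>i<d. \<bar>k i\<bar>) \<le> int L}"
  have geo: "(\<Sum>j = - int L..int L. (1/2::real) ^ nat \<bar>j\<bar>) \<le> 3"
  proof -
    have "(\<Sum>j = - int L..int L. (1/2::real) ^ nat \<bar>j\<bar>) = 3 - 2 * (1/2) ^ L"
    proof (induction L)
      case (Suc L)
      have "{- int (Suc L)..int (Suc L)} = insert (int (Suc L)) (insert (- int (Suc L)) {- int L..int L})"
        by auto
      then have "(\<Sum>j = - int (Suc L)..int (Suc L). (1/2::real) ^ nat \<bar>j\<bar>)
          = (\<Sum>j = - int L..int L. (1/2) ^ nat \<bar>j\<bar>) + 2 * (1/2) ^ Suc L"
        by (simp add: nat_add_distrib)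
      then show ?case using Suc by simp
    qed simp
    then show ?thesis by simp
  qed
  have fin: "finite ({..<d} \<rightarrow>\<^sub>E {- int L..int L})" by (intro finite_PiE) auto
  have "real (card ?S) * (1/2) ^ L = (\<Sum>k\<in>?S. (1/2) ^ L)" by simp
  also have "\<dots> \<le> (\<Sum>k\<in>?S. \<Prod>i<d. (1/2::real) ^ nat \<bar>k i\<bar>)"
  proof (rule sum_mono)
    fix k assume k: "k \<in> ?S"
    have "int (\<Sum>i<d. nat \<bar>k i\<bar>) = (\<Sum>i<d. \<bar>k i\<bar>)" by simp
    also have "\<dots> \<le> int L" using k by simp
    finally have "(\<Sum>i<d. nat \<bar>k i\<bar>) \<le> L" by (simp only: of_nat_le_iff)
    then have "(1/2::real) ^ L \<le> (1/2) ^ (\<Sum>i<d. nat \<bar>k i\<bar>)" by (intro power_decreasing) auto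
    then show "(1/2) ^ L \<le> (\<Prod>i<d. (1/2::real) ^ nat \<bar>k i\<bar>)" by (simp add: power_sum)
  qed
  also have "\<dots> \<le> (\<Sum>k\<in>{..<d} \<rightarrow>\<^sub>E {- int L..int L}. \<Prod>i<d. (1/2::real) ^ nat \<bar>k i\<bar>)"
  proof (rule sum_mono2[OF fin])
    show "0 \<le> (\<Prod>i<d. (1/2::real) ^ nat \<bar>k i\<bar>)" for k :: "nat \<Rightarrow> int"
      by (rule prod_nonneg) simp
  qed blast
  also have "\<dots> = (\<Prod>i<d. \<Sum>j = - int L..int L. (1/2::real) ^ nat \<bar>j\<bar>)"
    by (rule prod_sum_PiE[symmetric]) simp_all
  also have "\<dots> \<le> 3 ^ d"
  proof -
    have "0 \<le> (\<Sum>j = - int L..int L. (1/2::real) ^ nat \<bar>j\<bar>)" by (rule sum_nonneg) simp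
    from power_mono[OF geo this, of d] show ?thesis by (simp only: prod_constant card_lessThan)
  qed
  finally show ?thesis by (simp add: field_simps)
qed

text \<open>The net is the grid of mesh \<open>h = 1 / (r * sqrt d)\<close>. Rounding towards zero keeps the absolute values of the
coordinates from growing, and their sum is at most \<open>sqrt d\<close> on the unit sphere; so only grid points whose integer
coordinates have absolute values summing to at most \<open>sqrt d / h = r * d\<close> occur.\<close>

lemma sphere_net:
  fixes d r :: nat
  assumes d: "d > 0" and r: "r > 0"
  obtains U where "finite U" "U \<subseteq> coord_space d" "real (card U) \<le> 3 ^ d * 2 ^ (r * d)"
    "\<And>x. x \<in> coord_space d \<Longrightarrow> coord_norm d x = 1 \<Longrightarrow> \<exists>u\<in>U. coord_norm d (x - u) \<le> 1 / r"
proof -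
  define h :: real where "h = 1 / (real r * sqrt (real d))"
  have h: "h > 0" using assms by (simp add: h_def)
  define L where "L = r * d"
  define S where "S = {k \<in> {..<d} \<rightarrow>\<^sub>E {- int L..int L}. (\<Sum>i<d. \<bar>k i\<bar>) \<le> int L}"
  define g where "g k = (\<lambda>i. if i < d then h * real_of_int (k i) else 0)" for k :: "nat \<Rightarrow> int"
  have finS: "finite S" unfolding S_def by (rule finite_subset[of _ "{..<d} \<rightarrow>\<^sub>E {- int L..int L}"]) (auto intro!: finite_PiE)
  show thesis
  proof (rule that[of "g ` S"])
    show "finite (g ` S)" using finS by simp
    show "g ` S \<subseteq> coord_space d" by (auto simp: g_def coord_space_def)
    have "real (card (g ` S)) \<le> card S" using card_image_le[OF finS] by simp
    also have "\<dots> \<le> 3 ^ d * 2 ^ L" unfolding S_def by (rule card_integer_cross_polytope_le)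
    finally show "real (card (g ` S)) \<le> 3 ^ d * 2 ^ (r * d)" by (simp add: L_def)
  next
    fix x assume x: "x \<in> coord_space d" "coord_norm d x = 1"
    define k where "k = (\<lambda>i\<in>{..<d}. (if x i \<ge> 0 then \<lfloor>x i / h\<rfloor> else \<lceil>x i / h\<rceil>))"
    have k1: "\<bar>real_of_int (k i)\<bar> \<le> \<bar>x i\<bar> / h" if "i < d" for i
    proof (cases "x i \<ge> 0")
      case True
      then have "0 \<le> x i / h" using h by simp
      then have "0 \<le> \<lfloor>x i / h\<rfloor>" by simp
      moreover have "real_of_int \<lfloor>x i / h\<rfloor> \<le> x i / h" by (rule of_int_floor_le)
      ultimately show ?thesis using True that by (simp add: k_def)
    next
      case False
      then have "x i / h \<le> 0" using h by (simp add: divide_nonpos_pos)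
      then have "\<lceil>x i / h\<rceil> \<le> 0" by (simp add: ceiling_le_iff)
      moreover have "x i / h \<le> real_of_int \<lceil>x i / h\<rceil>" by (rule le_of_int_ceiling)
      ultimately show ?thesis using False that by (simp add: k_def)
    qed
    have k2: "\<bar>x i - h * real_of_int (k i)\<bar> \<le> h" if "i < d" for i
    proof -
      have "\<bar>x i / h - real_of_int (k i)\<bar> \<le> 1"
        using that unfolding k_def by auto linarith+
      then have "h * \<bar>x i / h - real_of_int (k i)\<bar> \<le> h * 1"
        using h by (intro mult_left_mono) auto
      moreover have "h * \<bar>x i / h - real_of_int (k i)\<bar> = \<bar>x i - h * real_of_int (k i)\<bar>"
        using h by (simp add: abs_mult_pos' right_diff_distrib)
      ultimately show ?thesis by simp
    qed
    have "(\<Sum>i<d. \<bar>x i\<bar>) \<le> L2_set x {..<d} * L2_set (\<lambda>_. 1) {..<d}"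
      using L2_set_mult_ineq[of x "\<lambda>_. 1" "{..<d}"] by simp
    also have "\<dots> = sqrt d" using x by (simp add: L2_set_def)
    finally have s: "(\<Sum>i<d. \<bar>x i\<bar>) \<le> sqrt d" .
    have "real_of_int (\<Sum>i<d. \<bar>k i\<bar>) \<le> (\<Sum>i<d. \<bar>x i\<bar> / h)"
      using k1 by (auto intro!: sum_mono)
    also have "\<dots> \<le> sqrt d / h" using s h by (simp flip: sum_divide_distrib add: divide_right_mono)
    also have "\<dots> = L" using assms by (simp add: h_def L_def)
    finally have sk: "(\<Sum>i<d. \<bar>k i\<bar>) \<le> int L" by linarith
    have "k i \<in> {- int L..int L}" if "i < d" for i
    proof -
      have "\<bar>k i\<bar> \<le> (\<Sum>i<d. \<bar>k i\<bar>)" using that by (intro member_le_sum) auto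
      with sk show ?thesis by auto
    qed
    moreover have "k \<in> extensional {..<d}" by (simp add: k_def)
    ultimately have kS: "k \<in> S" using sk unfolding S_def by (auto simp: PiE_def)
    have "L2_set (x - g k) {..<d} \<le> L2_set (\<lambda>_. h) {..<d}"
      unfolding L2_set_def using k2 h
      by (intro real_sqrt_le_mono sum_mono) (auto simp: g_def abs_le_square_iff[symmetric])
    also have "\<dots> = 1 / r" using h assms by (simp add: L2_set_def real_sqrt_mult h_def)
    finally show "\<exists>u\<in>g ` S. coord_norm d (x - u) \<le> 1 / r" using kS by blast
  qed
qed

section \<open>Distance from a point to an intersection of ellipsoids\<close>

text \<open>A point \<open>A\<close> of \<open>N\<close> stands for a positive semidefinite matrix and \<open>Q A y\<close> for the value of its quadratic form at the
vector with real coordinates \<open>y\<close>.\<close>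

locale psd_forms =
  fixes N :: "'a measure" and Q :: "'a \<Rightarrow> (nat \<Rightarrow> real) \<Rightarrow> real" and d :: nat
  assumes Q_measurable: "\<And>y. (\<lambda>A. Q A y) \<in> borel_measurable N"
    and Q_continuous: "\<And>A. A \<in> space N \<Longrightarrow> continuous_on UNIV (Q A)"
    and Q_convex: "\<And>A. A \<in> space N \<Longrightarrow> convex_on UNIV (Q A)"
    and Q_scale: "\<And>A c y. A \<in> space N \<Longrightarrow> Q A (c *\<^sub>R y) = c\<^sup>2 * Q A y"
    and Q_nonneg: "\<And>A y. A \<in> space N \<Longrightarrow> 0 \<le> Q A y"
begin

definition feasible :: "real \<Rightarrow> 'i set \<Rightarrow> ('i \<Rightarrow> 'a) \<Rightarrow> (nat \<Rightarrow> real) set" where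
  "feasible a S A = {y \<in> coord_space d. \<forall>i\<in>S. Q (A i) y \<le> a}"

definition feas_dist :: "real \<Rightarrow> (nat \<Rightarrow> real) \<Rightarrow> 'i set \<Rightarrow> ('i \<Rightarrow> 'a) \<Rightarrow> real" where
  "feas_dist a u S A = (INF y\<in>feasible a S A. coord_norm d (y - u))"

end

lemma coord_space_add: "x \<in> coord_space d \<Longrightarrow> y \<in> coord_space d \<Longrightarrow> x + y \<in> coord_space d"
  and coord_space_scale: "x \<in> coord_space d \<Longrightarrow> c *\<^sub>R x \<in> coord_space d"
  and coord_space_0: "0 \<in> coord_space d"
  by (auto simp: coord_space_def)

lemma coord_norm_triangle: "coord_norm d (x + y) \<le> coord_norm d x + coord_norm d y"
  using L2_set_triangle_ineq[of x y "{..<d}"] by (simp add: plus_fun_def)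

lemma coord_norm_scale: "coord_norm d (c *\<^sub>R x) = \<bar>c\<bar> * coord_norm d x"
  by (simp add: L2_set_def power_mult_distrib real_sqrt_mult flip: sum_distrib_left)

lemma coord_norm_minus_commute: "coord_norm d (x - y) = coord_norm d (y - x)"
  by (simp add: L2_set_def power2_commute)

lemma coord_norm_eq_0D: "coord_norm d (x - y) = 0 \<Longrightarrow> x \<in> coord_space d \<Longrightarrow> y \<in> coord_space d \<Longrightarrow> x = y"
  by (force simp: coord_space_def L2_set_eq_0_iff fun_eq_iff not_le[symmetric])

text \<open>The parallelogram law, which makes the closest point of a convex set unique.\<close>

lemma coord_norm_midpoint:
  "(coord_norm d ((1/2) *\<^sub>R (y + z) - u))\<^sup>2 =
     (coord_norm d (y - u))\<^sup>2 / 2 + (coord_norm d (z - u))\<^sup>2 / 2 - (coord_norm d (y - z))\<^sup>2 / 4"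
proof -
  have sq: "(coord_norm d x)\<^sup>2 = (\<Sum>i<d. (x i)\<^sup>2)" for x
    by (simp add: L2_set_def sum_nonneg)
  have "(((1/2) *\<^sub>R (y + z) - u) i)\<^sup>2 = ((y - u) i)\<^sup>2 / 2 + ((z - u) i)\<^sup>2 / 2 - ((y - z) i)\<^sup>2 / 4" for i
    by (simp add: power2_eq_square field_simps)
  then show ?thesis
    unfolding sq by (simp only: sum.distrib sum_subtractf sum_divide_distrib)
qed

lemma continuous_on_coord_norm: "continuous_on UNIV (\<lambda>y::nat \<Rightarrow> real. coord_norm d (y - u))"
  unfolding L2_set_def by (auto intro!: continuous_intros)

lemma convex_coord_ball: "convex {y \<in> coord_space d. coord_norm d (y - u) < r}"
proof (rule convexI)
  fix x y :: "nat \<Rightarrow> real" and s t :: real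
  assume x: "x \<in> {y \<in> coord_space d. coord_norm d (y - u) < r}"
    and y: "y \<in> {y \<in> coord_space d. coord_norm d (y - u) < r}" and st: "0 \<le> s" "0 \<le> t" "s + t = 1"
  have "s *\<^sub>R x + t *\<^sub>R y - u = s *\<^sub>R (x - u) + t *\<^sub>R (y - u)"
  proof -
    have "s *\<^sub>R (x - u) + t *\<^sub>R (y - u) = s *\<^sub>R x + t *\<^sub>R y - (s + t) *\<^sub>R u"
      by (simp add: algebra_simps)
    then show ?thesis using st by simp
  qed
  then have "coord_norm d (s *\<^sub>R x + t *\<^sub>R y - u) \<le> s * coord_norm d (x - u) + t * coord_norm d (y - u)"
    using coord_norm_triangle[of "s *\<^sub>R (x - u)" "t *\<^sub>R (y - u)" d] st by (simp only: coord_norm_scale abs_of_nonneg)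
  also have "\<dots> < r" using x y st by (intro convex_bound_lt) auto
  finally show "s *\<^sub>R x + t *\<^sub>R y \<in> {y \<in> coord_space d. coord_norm d (y - u) < r}"
    using x y by (auto intro!: coord_space_add coord_space_scale)
qed

text \<open>For the product topology, the closed balls of \<open>\<real>\<^sup>d\<close> are closed subsets of a product of compact intervals, by
Tychonoff's theorem.\<close>

lemma compact_coord_cball: "compact {y \<in> coord_space d. coord_norm d (y - u) \<le> r}"
proof -
  define S where "S = (\<lambda>i. if i < d then {u i - r..u i + r} else {0::real})"
  have "compactin (product_topology (\<lambda>i. euclidean) UNIV) (PiE UNIV S)"
    by (subst compactin_PiE) (auto simp: S_def)
  then have c: "compact (PiE UNIV S)"
    by (simp add: euclidean_product_topology)
  have cl: "closed {y. coord_norm d (y - u) \<le> r}"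
    by (intro closed_Collect_le continuous_on_coord_norm continuous_intros)
  have cs: "closed (coord_space d)"
  proof -
    have "coord_space d = (\<Inter>i\<in>{d..}. {y. y i = 0})" by (auto simp: coord_space_def)
    also have "closed \<dots>" by (intro closed_INT ballI closed_Collect_eq continuous_intros) auto
    finally show ?thesis .
  qed
  have sub: "{y \<in> coord_space d. coord_norm d (y - u) \<le> r} \<subseteq> PiE UNIV S"
  proof safe
    fix y i assume y: "y \<in> coord_space d" "coord_norm d (y - u) \<le> r"
    show "y i \<in> S i"
    proof (cases "i < d")
      case True
      have "\<bar>(y - u) i\<bar> \<le> coord_norm d (y - u)"
        using member_le_L2_set[of "{..<d}" i "\<lambda>i. \<bar>(y - u) i\<bar>"] True by (simp add: L2_set_def)
      with y True show ?thesis by (auto simp: S_def)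
    qed (use y in \<open>auto simp: S_def coord_space_def\<close>)
  qed auto
  have "{y \<in> coord_space d. coord_norm d (y - u) \<le> r} = PiE UNIV S \<inter> (coord_space d \<inter> {y. coord_norm d (y - u) \<le> r})"
    using sub by blast
  then show ?thesis using compact_Int_closed[OF c closed_Int[OF cs cl]] by simp
qed

context psd_forms
begin

lemma Q_0: "A \<in> space N \<Longrightarrow> Q A 0 = 0"
  using Q_scale[of A 0 0] by simp

lemma zero_feasible: "\<lbrakk>\<forall>i\<in>S. A i \<in> space N; a \<ge> 0\<rbrakk> \<Longrightarrow> 0 \<in> feasible a S A"
  by (auto simp: feasible_def coord_space_0 Q_0)

lemma feas_dist_le: "y \<in> feasible a S A \<Longrightarrow> feas_dist a u S A \<le> coord_norm d (y - u)"
  unfolding feas_dist_def by (rule cINF_lower) (auto intro: bdd_belowI[of _ 0])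

lemma convex_feasible_single: "A \<in> space N \<Longrightarrow> convex {y. Q A y \<le> a}"
proof (rule convexI)
  fix x y :: "nat \<Rightarrow> real" and s t :: real
  assume A: "A \<in> space N" and xy: "x \<in> {y. Q A y \<le> a}" "y \<in> {y. Q A y \<le> a}"
    and st: "0 \<le> s" "0 \<le> t" "s + t = 1"
  have "Q A (s *\<^sub>R x + t *\<^sub>R y) \<le> s * Q A x + t * Q A y"
    using Q_convex[OF A] st unfolding convex_on_def by auto
  also have "\<dots> \<le> a" using xy st by (intro convex_bound_le) auto
  finally show "s *\<^sub>R x + t *\<^sub>R y \<in> {y. Q A y \<le> a}" by simp
qed

lemma feas_dist_attained:
  assumes A: "\<forall>i\<in>S. A i \<in> space N" and a: "a \<ge> 0"
  obtains y where "y \<in> feasible a S A" "coord_norm d (y - u) = feas_dist a u S A"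
proof -
  define K where "K = {y \<in> coord_space d. coord_norm d (y - u) \<le> coord_norm d (0 - u)} \<inter> (\<Inter>i\<in>S. {y. Q (A i) y \<le> a})"
  have cl: "closed (\<Inter>i\<in>S. {y. Q (A i) y \<le> a})"
    using A by (auto intro!: closed_INT closed_Collect_le Q_continuous continuous_intros)
  have K: "compact K" unfolding K_def by (rule compact_Int_closed[OF compact_coord_cball cl])
  have 0: "0 \<in> K" using zero_feasible[OF A a] by (auto simp: feasible_def K_def)
  have "continuous_on K (\<lambda>y. coord_norm d (y - u))"
    by (rule continuous_on_subset[OF continuous_on_coord_norm]) auto
  moreover have "K \<noteq> {}" using 0 by blast
  ultimately obtain y where y: "y \<in> K" "\<And>z. z \<in> K \<Longrightarrow> coord_norm d (y - u) \<le> coord_norm d (z - u)"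
    using continuous_attains_inf[OF K, of "\<lambda>y. coord_norm d (y - u)"] by blast
  have yf: "y \<in> feasible a S A" using y(1) by (auto simp: feasible_def K_def)
  have "coord_norm d (y - u) \<le> coord_norm d (z - u)" if "z \<in> feasible a S A" for z
  proof (cases "coord_norm d (z - u) \<le> coord_norm d (0 - u)")
    case True then show ?thesis using that y(2)[of z] by (auto simp: feasible_def K_def)
  next
    case False then show ?thesis using y(2)[OF 0] by linarith
  qed
  then have "coord_norm d (y - u) \<le> feas_dist a u S A"
    unfolding feas_dist_def using yf by (intro cINF_greatest) auto
  with feas_dist_le[OF yf, of u] yf show thesis by (intro that[of y]) auto
qed

lemma closest_feasible_unique:
  assumes A: "\<forall>i\<in>S. A i \<in> space N"
    and y: "y \<in> feasible a S A" "coord_norm d (y - u) \<le> feas_dist a u S A"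
    and z: "z \<in> feasible a S A" "coord_norm d (z - u) \<le> feas_dist a u S A"
  shows "y = z"
proof -
  let ?D = "feas_dist a u S A"
  let ?w = "(1/2) *\<^sub>R (y + z)"
  have "?w = (1/2) *\<^sub>R y + (1/2) *\<^sub>R z" by (simp add: scaleR_add_right)
  then have "?w \<in> feasible a S A"
    using y z A convexD[OF convex_feasible_single, of _ y a z "1/2" "1/2"]
    by (auto simp: feasible_def intro!: coord_space_add coord_space_scale)
  from feas_dist_le[OF this, of u] have w: "?D \<le> coord_norm d (?w - u)" .
  have D: "coord_norm d (y - u) = ?D" "coord_norm d (z - u) = ?D"
    using y z feas_dist_le[OF y(1), of u] feas_dist_le[OF z(1), of u] by auto
  have "?D \<ge> 0" using D(1) by (metis L2_set_nonneg)
  then have "?D\<^sup>2 \<le> (coord_norm d (?w - u))\<^sup>2" using w by (intro power_mono)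
  then have "(coord_norm d (y - z))\<^sup>2 \<le> 0" unfolding coord_norm_midpoint D by simp
  then have "coord_norm d (y - z) = 0" by simp
  then show ?thesis using y z by (intro coord_norm_eq_0D) (auto simp: feasible_def)
qed

lemma feas_dist_mono:
  assumes "\<forall>i\<in>S'. A i \<in> space N" "a \<ge> 0" "S \<subseteq> S'"
  shows "feas_dist a u S A \<le> feas_dist a u S' A"
proof -
  obtain y where "y \<in> feasible a S' A" "coord_norm d (y - u) = feas_dist a u S' A"
    using feas_dist_attained[OF assms(1,2)] .
  moreover from this have "y \<in> feasible a S A" using assms(3) by (auto simp: feasible_def)
  ultimately show ?thesis using feas_dist_le by metis
qed

lemma feas_dist_cong: "(\<And>i. i \<in> S \<Longrightarrow> A i = A' i) \<Longrightarrow> feas_dist a u S A = feas_dist a u S A'"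
  by (simp add: feas_dist_def feasible_def)

text \<open>The open ball around \<open>u\<close> of radius \<open>feas_dist a u J A\<close> misses the intersection of all ellipsoids. By Helly's
theorem it already misses the intersection of few of them.\<close>

lemma feas_dist_compression:
  assumes J: "finite J" and A: "\<forall>i\<in>J. A i \<in> space N" and a: "a \<ge> 0"
  obtains I where "I \<subseteq> J" "card I \<le> d + 1" "feas_dist a u I A = feas_dist a u J A"
proof -
  obtain B where B: "finite B" "card B \<le> d" "coord_space d \<subseteq> span B" by (rule coord_space_span)
  let ?D = "feas_dist a u J A"
  define W where "W = {y \<in> coord_space d. coord_norm d (y - u) < ?D}"
  have "\<not> (\<exists>y\<in>W. \<forall>i\<in>J. y \<in> {y. Q (A i) y \<le> a})"
  proof
    assume "\<exists>y\<in>W. \<forall>i\<in>J. y \<in> {y. Q (A i) y \<le> a}"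
    then obtain y where "y \<in> feasible a J A" "coord_norm d (y - u) < ?D"
      by (auto simp: feasible_def W_def)
    then show False using feas_dist_le[of y a J A u] by simp
  qed
  moreover have "convex W" unfolding W_def by (rule convex_coord_ball)
  moreover have "W \<subseteq> span B" using B(3) by (auto simp: W_def)
  moreover have "\<And>i. i \<in> J \<Longrightarrow> convex {y. Q (A i) y \<le> a}" using A by (intro convex_feasible_single) blast
  ultimately have "\<exists>I. I \<subseteq> J \<and> card I \<le> card B + 1 \<and> \<not> (\<exists>y\<in>W. \<forall>i\<in>I. y \<in> {y. Q (A i) y \<le> a})"
    using Helly_span[OF B(1) J, of "\<lambda>i. {y. Q (A i) y \<le> a}" W] by blast
  then obtain I where I: "I \<subseteq> J" "card I \<le> card B + 1" "\<not> (\<exists>y\<in>W. \<forall>i\<in>I. y \<in> {y. Q (A i) y \<le> a})"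
    by blast
  have AI: "\<forall>i\<in>I. A i \<in> space N" using A I by auto
  obtain y where y: "y \<in> feasible a I A" "coord_norm d (y - u) = feas_dist a u I A"
    using feas_dist_attained[OF AI a] .
  have "\<not> coord_norm d (y - u) < ?D"
  proof
    assume "coord_norm d (y - u) < ?D"
    then have "y \<in> W" using y(1) by (simp add: W_def feasible_def)
    moreover have "\<forall>i\<in>I. y \<in> {y. Q (A i) y \<le> a}" using y(1) by (simp add: feasible_def)
    ultimately show False using I(3) by blast
  qed
  then have "?D \<le> feas_dist a u I A" using y(2) by simp
  with feas_dist_mono[OF A a I(1), of u] have "feas_dist a u I A = ?D" by simp
  then show thesis using I B that by simp
qed

text \<open>By compactness, a ball of radius \<open>r\<close> meets the feasible set if and only if the total violation \<open>g\<close> of the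
constraints gets arbitrarily small on the ball, and by continuity it is enough to test this on a countable dense subset.\<close>

lemma feas_dist_measurable:
  assumes S: "finite S" "S \<subseteq> K" and a: "a \<ge> 0"
  shows "feas_dist a u S \<in> borel_measurable (Pi\<^sub>M K (\<lambda>_. N))"
proof (rule borel_measurableI_le)
  fix r :: real
  let ?K = "{y \<in> coord_space d. coord_norm d (y - u) \<le> r}"
  define g where "g A q = (\<Sum>i\<in>S. max 0 (Q (A i) q - a))" for A :: "'b \<Rightarrow> 'a" and q
  obtain T where T: "countable T" "T \<subseteq> ?K" "?K \<subseteq> closure T" by (rule separable)
  have iff: "feas_dist a u S A \<le> r \<longleftrightarrow> (\<forall>k::nat. \<exists>q\<in>T. g A q < 1 / real (Suc k))"
    if A: "A \<in> space (Pi\<^sub>M K (\<lambda>_. N))" for A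
  proof -
    have AN: "\<forall>i\<in>S. A i \<in> space N" using A S by (auto simp: space_PiM)
    have gc: "continuous_on UNIV (g A)" unfolding g_def
      using AN by (intro continuous_intros Q_continuous) auto
    have g0: "0 \<le> g A q" for q by (auto simp: g_def intro!: sum_nonneg)
    have "\<forall>k::nat. \<exists>q\<in>T. g A q < 1 / real (Suc k)" if le: "feas_dist a u S A \<le> r"
    proof -
      obtain y where "y \<in> feasible a S A" "coord_norm d (y - u) = feas_dist a u S A"
        using feas_dist_attained[OF AN a] .
      with le have y: "y \<in> ?K" "g A y = 0" by (auto simp: feasible_def g_def)
      show ?thesis
      proof
        fix k :: nat
        have "open {q. g A q < 1 / real (Suc k)}"
          by (intro open_Collect_less gc continuous_intros)
        moreover have "y \<in> {q. g A q < 1 / real (Suc k)} \<inter> closure T" using y T by auto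
        ultimately have "{q. g A q < 1 / real (Suc k)} \<inter> T \<noteq> {}"
          using open_Int_closure_eq_empty by blast
        then show "\<exists>q\<in>T. g A q < 1 / real (Suc k)"
          by blast
      qed
    qed
    moreover have "feas_dist a u S A \<le> r" if *: "\<forall>k::nat. \<exists>q\<in>T. g A q < 1 / real (Suc k)"
    proof -
      from * have "T \<noteq> {}" by blast
      then have "?K \<noteq> {}" using T(2) by blast
      then obtain y where y: "y \<in> ?K" "\<And>z. z \<in> ?K \<Longrightarrow> g A y \<le> g A z"
        using continuous_attains_inf[OF compact_coord_cball _ continuous_on_subset[OF gc subset_UNIV]] by blast
      have "g A y \<le> 0"
      proof (rule ccontr)
        assume "\<not> g A y \<le> 0"
        then obtain k where "1 / real (Suc k) < g A y"
          using reals_Archimedean[of "g A y"] by (auto simp: inverse_eq_divide)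
        moreover obtain q where "q \<in> T" "g A q < 1 / real (Suc k)" using * by metis
        ultimately show False using y(2)[of q] T by force
      qed
      with g0[of y] have "g A y = 0" by simp
      then have "\<forall>i\<in>S. Q (A i) y \<le> a"
        unfolding g_def using S by (subst (asm) sum_nonneg_eq_0_iff) auto
      then have "y \<in> feasible a S A" using y by (auto simp: feasible_def)
      from feas_dist_le[OF this, of u] y show ?thesis by simp
    qed
    ultimately show ?thesis by blast
  qed
  have [measurable]: "(\<lambda>A. g A q) \<in> borel_measurable (Pi\<^sub>M K (\<lambda>_. N))" for q
  proof -
    have [measurable]: "(\<lambda>A. Q (A i) q) \<in> borel_measurable (Pi\<^sub>M K (\<lambda>_. N))" if "i \<in> S" for i
      using S that by (intro measurable_compose[where f = "\<lambda>A. A i" and g = "\<lambda>x. Q x q", OF _ Q_measurable]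
        measurable_component_singleton) auto
    show ?thesis unfolding g_def by measurable
  qed
  have "{A \<in> space (Pi\<^sub>M K (\<lambda>_. N)). feas_dist a u S A \<le> r}
      = {A \<in> space (Pi\<^sub>M K (\<lambda>_. N)). \<forall>k::nat. \<exists>q\<in>T. g A q < 1 / real (Suc k)}"
    using iff by auto
  also have "\<dots> \<in> sets (Pi\<^sub>M K (\<lambda>_. N))" using T(1) by measurable
  finally show "{A \<in> space (Pi\<^sub>M K (\<lambda>_. N)). feas_dist a u S A \<le> r} \<in> sets (Pi\<^sub>M K (\<lambda>_. N))" .
qed

end

section \<open>The probability that few constraints move the closest point\<close>

lemma one_minus_le_exp_minus: "1 - x \<le> exp (- x)" for x :: real
  using exp_ge_add_one_self[of "- x"] by simp

text \<open>The factor that one independent trial contributes to the Chernoff bound.\<close>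

lemma (in prob_space) nn_integral_exp_indicator_le:
  fixes s p :: real
  assumes E: "E \<in> sets M" and s: "s \<ge> 0" and p: "p \<le> prob E"
  shows "(\<integral>\<^sup>+z. ennreal (exp (- s * indicator E z)) \<partial>M) \<le> ennreal (exp (- (1 - exp (- s)) * p))"
proof -
  have eq: "exp (- s * indicator E z) = 1 - (1 - exp (- s)) * indicator E z" for z
    by (auto simp: indicator_def)
  have "(\<integral>\<^sup>+z. ennreal (exp (- s * indicator E z)) \<partial>M) = ennreal (\<integral>z. exp (- s * indicator E z) \<partial>M)"
  proof (rule nn_integral_eq_integral)
    show "integrable M (\<lambda>z. exp (- s * indicator E z))"
      unfolding eq using E by (intro Bochner_Integration.integrable_diff integrable_mult_right integrable_real_indicator)
        (auto simp: emeasure_eq_measure)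
  qed auto
  also have "(\<integral>z. exp (- s * indicator E z) \<partial>M) = 1 - (1 - exp (- s)) * prob E"
    unfolding eq using E
    by (subst Bochner_Integration.integral_diff) (auto simp: prob_space emeasure_eq_measure integrable_real_indicator)
  also have "\<dots> \<le> exp (- ((1 - exp (- s)) * prob E))" by (rule one_minus_le_exp_minus)
  also have "\<dots> \<le> exp (- (1 - exp (- s)) * p)"
  proof -
    have "(1 - exp (- s)) * p \<le> (1 - exp (- s)) * prob E" using s p by (intro mult_left_mono) auto
    then show ?thesis by (simp only: exp_le_cancel_iff mult_minus_left neg_le_iff_le)
  qed
  finally show ?thesis by (simp add: ennreal_leI)
qed

context psd_forms
begin

text \<open>Suppose that adding \<open>j\<close> does not increase the distance. Then the closest point \<open>y\<close> for \<open>I\<close> also satisfies the constraint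
\<open>j\<close>, because the closest point is unique. But \<open>y\<close> has norm at least \<open>1 - 2 * \<delta>\<close>, and the level
\<open>(1 - 2 * \<delta>)\<^sup>2 * \<alpha>\<close> of the ellipsoids is chosen so that the normalized \<open>y\<close> would have form at most \<open>\<alpha>\<close>.\<close>

lemma feas_dist_increases:
  assumes A: "\<forall>i\<in>insert j I. A i \<in> space N" and al: "\<alpha> \<ge> 0" and del: "0 \<le> \<delta>" "\<delta> < 1 / 2"
    and u: "coord_norm d u \<ge> 1 - \<delta>" and D: "feas_dist ((1 - 2 * \<delta>)\<^sup>2 * \<alpha>) u I A \<le> \<delta>"
    and y: "y \<in> feasible ((1 - 2 * \<delta>)\<^sup>2 * \<alpha>) I A"
      "coord_norm d (y - u) = feas_dist ((1 - 2 * \<delta>)\<^sup>2 * \<alpha>) u I A"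
    and Q: "Q (A j) ((1 / coord_norm d y) *\<^sub>R y) > \<alpha>"
  shows "feas_dist ((1 - 2 * \<delta>)\<^sup>2 * \<alpha>) u I A < feas_dist ((1 - 2 * \<delta>)\<^sup>2 * \<alpha>) u (insert j I) A"
proof (rule ccontr)
  let ?a = "(1 - 2 * \<delta>)\<^sup>2 * \<alpha>"
  assume "\<not> ?thesis"
  moreover obtain z where z: "z \<in> feasible ?a (insert j I) A"
    "coord_norm d (z - u) = feas_dist ?a u (insert j I) A"
    using feas_dist_attained[OF A, of ?a u] al by auto
  ultimately have "coord_norm d (z - u) \<le> feas_dist ?a u I A" by simp
  moreover have "z \<in> feasible ?a I A" using z by (auto simp: feasible_def)
  ultimately have "z = y" using y A by (intro closest_feasible_unique[of I A z ?a u y]) auto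
  then have Qy: "Q (A j) y \<le> ?a" using z by (auto simp: feasible_def)
  have "coord_norm d u \<le> coord_norm d y + coord_norm d (u - y)"
    using coord_norm_triangle[of y "u - y" d] by simp
  then have ny: "coord_norm d y \<ge> 1 - 2 * \<delta>"
    using y(2) D u by (simp add: coord_norm_minus_commute)
  have "Q (A j) y > \<alpha> * (coord_norm d y)\<^sup>2"
    using Q A ny del by (simp add: Q_scale power_divide field_simps)
  moreover have "(1 - 2 * \<delta>)\<^sup>2 \<le> (coord_norm d y)\<^sup>2" using ny del by (intro power_mono) auto
  then have "?a \<le> \<alpha> * (coord_norm d y)\<^sup>2" using al by (simp add: mult.commute mult_left_mono)
  ultimately show False using Qy by linarith
qed

text \<open>A Chernoff bound with parameter \<open>s\<close>, conditionally on the matrices with index in \<open>I\<close>. These determine the closest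
point \<open>y\<close>, and by \<open>feas_dist_increases\<close> each further matrix increases the distance at least with the probability that its
form exceeds \<open>\<alpha>\<close> at the normalized \<open>y\<close>. The hypothesis \<open>tail\<close> bounds the sum of these probabilities from
below; leaving out the indices in \<open>I\<close> costs at most \<open>card I\<close>.\<close>

lemma prob_few_increases:
  fixes \<mu> :: "'i \<Rightarrow> 'a measure"
  assumes \<mu>: "\<And>i. prob_space (\<mu> i)" "\<And>i. sets (\<mu> i) = sets N"
    and K: "finite K" "I \<subseteq> K" and al: "\<alpha> \<ge> 0" and del: "0 \<le> \<delta>" "\<delta> < 1 / 2"
    and u: "coord_norm d u \<ge> 1 - \<delta>" and s: "s \<ge> 0"
    and tail: "\<And>y. y \<in> coord_space d \<Longrightarrow> coord_norm d y = 1 \<Longrightarrow>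
        b \<le> (\<Sum>i\<in>K. measure (\<mu> i) {A \<in> space N. Q A y > \<alpha>})"
  defines "a \<equiv> (1 - 2 * \<delta>)\<^sup>2 * \<alpha>"
  shows "{A \<in> space (Pi\<^sub>M K \<mu>). feas_dist a u I A \<le> \<delta> \<and>
            real (card {j \<in> K - I. feas_dist a u I A < feas_dist a u (insert j I) A}) \<le> \<kappa>} \<in> sets (Pi\<^sub>M K \<mu>)" (is "?G \<in> _")
    and "emeasure (Pi\<^sub>M K \<mu>) {A \<in> space (Pi\<^sub>M K \<mu>). feas_dist a u I A \<le> \<delta> \<and>
            real (card {j \<in> K - I. feas_dist a u I A < feas_dist a u (insert j I) A}) \<le> \<kappa>}
         \<le> ennreal (exp (s * \<kappa> - (1 - exp (- s)) * (b - real (card I))))"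
proof -
  define J where "J = K - I"
  have fin: "finite I" "finite J" using K by (auto simp: J_def finite_subset)
  have IJ: "I \<inter> J = {}" "I \<union> J = K" using K by (auto simp: J_def)
  have a0: "a \<ge> 0" using al by (simp add: a_def)
  interpret mu: prob_space "\<mu> i" for i by (rule \<mu>)
  interpret P: product_prob_space \<mu> by unfold_locales
  have spmu: "space (\<mu> i) = space N" for i using sets_eq_imp_space_eq[OF \<mu>(2)] .
  have setsPi: "sets (Pi\<^sub>M L \<mu>) = sets (Pi\<^sub>M L (\<lambda>_. N))" for L :: "'i set"
    by (intro sets_PiM_cong \<mu> refl)
  have mD: "feas_dist a u S \<in> borel_measurable (Pi\<^sub>M L \<mu>)" if "S \<subseteq> L" "finite S" for S L
    using feas_dist_measurable[OF that(2,1) a0] by (simp add: measurable_cong_sets[OF setsPi refl])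
  define h :: "'i \<Rightarrow> ('i \<Rightarrow> 'a) \<Rightarrow> real"
    where "h j A = indicator {A. feas_dist a u I A < feas_dist a u (insert j I) A} A" for j and A :: "'i \<Rightarrow> 'a"
  have mDI[measurable]: "feas_dist a u I \<in> borel_measurable (Pi\<^sub>M K \<mu>)" using K fin by (intro mD) auto
  have mh[measurable]: "(\<lambda>A. h j A :: real) \<in> borel_measurable (Pi\<^sub>M K \<mu>)" if "j \<in> J" for j
  proof -
    have [measurable]: "feas_dist a u (insert j I) \<in> borel_measurable (Pi\<^sub>M K \<mu>)"
      using K fin that by (intro mD) (auto simp: J_def)
    show ?thesis unfolding h_def by measurable
  qed
  have cardh: "real (card {j \<in> K - I. feas_dist a u I A < feas_dist a u (insert j I) A}) = (\<Sum>j\<in>J. h j A)" for A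
    unfolding h_def J_def using K by (simp add: sum.If_cases indicator_def Int_def)
  have "?G = {A \<in> space (Pi\<^sub>M K \<mu>). feas_dist a u I A \<le> \<delta> \<and> (\<Sum>j\<in>J. h j A) \<le> \<kappa>}"
    by (simp only: cardh)
  also have "\<dots> \<in> sets (Pi\<^sub>M K \<mu>)" by measurable
  finally show G: "?G \<in> sets (Pi\<^sub>M K \<mu>)" .
  \<comment> \<open>Markov's inequality for the exponential moment: F dominates the indicator of the event and, for a fixed restriction of A to I, is a product of functions of the single matrices with index in J.\<close>
  define F where "F A = indicator {A. feas_dist a u I A \<le> \<delta>} A * ennreal (exp (s * \<kappa>)) * (\<Prod>j\<in>J. ennreal (exp (- s * h j A)))"
    for A :: "'i \<Rightarrow> 'a"
  have mF[measurable]: "F \<in> borel_measurable (Pi\<^sub>M K \<mu>)" unfolding F_def by measurable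
  let ?R = "ennreal (exp (s * \<kappa> - (1 - exp (- s)) * (b - real (card I))))"
  have le: "indicator ?G A \<le> F A" for A
  proof (cases "A \<in> ?G")
    case True
    then have "(\<Sum>j\<in>J. h j A) \<le> \<kappa>" "feas_dist a u I A \<le> \<delta>"
      by (simp_all only: cardh[symmetric] mem_Collect_eq)
    then have "1 \<le> exp (s * \<kappa> - s * (\<Sum>j\<in>J. h j A))" using s by (simp add: mult_left_mono)
    also have "\<dots> = exp (s * \<kappa>) * (\<Prod>j\<in>J. exp (- s * h j A))"
    proof -
      have "(\<Prod>j\<in>J. exp (- s * h j A)) = exp (- (s * (\<Sum>j\<in>J. h j A)))"
        using exp_sum[OF fin(2), of "\<lambda>j. - s * h j A"] by (simp add: sum_negf sum_distrib_left)
      then show ?thesis by (simp flip: exp_add)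
    qed
    finally have "1 \<le> ennreal (exp (s * \<kappa>)) * (\<Prod>j\<in>J. ennreal (exp (- s * h j A)))"
      by (simp add: prod_ennreal ennreal_mult[symmetric] prod_nonneg)
    then show ?thesis using True by (simp add: F_def)
  qed simp
  have inner: "(\<integral>\<^sup>+y. F (merge I J (x, y)) \<partial>Pi\<^sub>M J \<mu>) \<le> ?R" if x: "x \<in> space (Pi\<^sub>M I \<mu>)" for x
  proof (cases "feas_dist a u I x \<le> \<delta>")
    case False
    have "feas_dist a u I (merge I J (x, y)) = feas_dist a u I x" for y
      by (rule feas_dist_cong) (simp add: merge_def)
    then show ?thesis using False by (simp add: F_def)
  next
    case True
    have xN: "x i \<in> space N" if "i \<in> I" for i using x that by (auto simp: space_PiM spmu)
    obtain y where y: "y \<in> feasible a I x" "coord_norm d (y - u) = feas_dist a u I x"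
      using feas_dist_attained[of I x a u] xN a0 by blast
    \<comment> \<open>y is not zero: u has norm at least \<open>1 - \<delta> > \<delta>\<close>, and y has distance at most \<open>\<delta>\<close> from u.\<close>
    define w where "w = (1 / coord_norm d y) *\<^sub>R y"
    have ny: "coord_norm d y > 0"
      using coord_norm_triangle[of y "u - y" d] y(2) True u del by (simp add: coord_norm_minus_commute)
    have w: "w \<in> coord_space d" "coord_norm d w = 1"
      using y ny by (auto simp: w_def coord_norm_scale feasible_def intro!: coord_space_scale)
    define E where "E j = {z \<in> space N. feas_dist a u I x < feas_dist a u (insert j I) (x(j := z))}" for j
    have E: "E j \<in> sets (\<mu> j)" if j: "j \<in> J" for j
    proof -
      have "j \<notin> I" using j by (simp add: J_def)
      have "(\<lambda>z. x(j := z)) \<in> measurable (\<mu> j) (Pi\<^sub>M (insert j I) \<mu>)"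
        using x \<open>j \<notin> I\<close> by (rule measurable_component_update)
      moreover have "feas_dist a u (insert j I) \<in> borel_measurable (Pi\<^sub>M (insert j I) \<mu>)"
        using fin by (intro mD) auto
      ultimately have [measurable]: "(\<lambda>z. feas_dist a u (insert j I) (x(j := z))) \<in> borel_measurable (\<mu> j)"
        by (rule measurable_compose)
      show ?thesis unfolding E_def spmu[of j, symmetric] by measurable
    qed
    have pE: "measure (\<mu> j) {A \<in> space N. Q A w > \<alpha>} \<le> measure (\<mu> j) (E j)" if j: "j \<in> J" for j
    proof (rule mu.finite_measure_mono[OF _ E[OF j]], safe)
      fix A assume A: "A \<in> space N" "Q A w > \<alpha>"
      have jI: "j \<notin> I" using j by (simp add: J_def)
      have c: "feas_dist a u I (x(j := A)) = feas_dist a u I x"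
        using jI by (intro feas_dist_cong) auto
      have f: "feasible a I (x(j := A)) = feasible a I x"
        using jI by (auto simp: feasible_def)
      have "feas_dist a u I (x(j := A)) < feas_dist a u (insert j I) (x(j := A))"
        unfolding a_def
      proof (rule feas_dist_increases[OF _ al del u, where y = y])
        show "\<forall>i\<in>insert j I. (x(j := A)) i \<in> space N" using A xN by auto
      qed (use A True y in \<open>auto simp: c f w_def simp flip: a_def\<close>)
      then show "A \<in> E j" using A by (simp add: E_def c)
    qed
    have Fm: "F (merge I J (x, z)) = ennreal (exp (s * \<kappa>)) * (\<Prod>j\<in>J. ennreal (exp (- s * indicator (E j) (z j))))"
      if z: "z \<in> space (Pi\<^sub>M J \<mu>)" for z
    proof -
      have DI: "feas_dist a u I (merge I J (x, z)) = feas_dist a u I x"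
        by (rule feas_dist_cong) (simp add: merge_def)
      have "h j (merge I J (x, z)) = (indicator (E j) (z j) :: real)" if j: "j \<in> J" for j
      proof -
        have "feas_dist a u (insert j I) (merge I J (x, z)) = feas_dist a u (insert j I) (x(j := z j))"
          using j by (intro feas_dist_cong) (auto simp: merge_def J_def)
        moreover have "z j \<in> space N" using z j by (auto simp: space_PiM spmu)
        ultimately show ?thesis by (simp add: h_def E_def DI indicator_def)
      qed
      then show ?thesis using True by (simp add: F_def DI cong: prod.cong)
    qed
    have "(\<integral>\<^sup>+z. F (merge I J (x, z)) \<partial>Pi\<^sub>M J \<mu>)
        = (\<integral>\<^sup>+z. ennreal (exp (s * \<kappa>)) * (\<Prod>j\<in>J. ennreal (exp (- s * indicator (E j) (z j)))) \<partial>Pi\<^sub>M J \<mu>)"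
      by (rule nn_integral_cong) (rule Fm)
    also have "\<dots> = ennreal (exp (s * \<kappa>)) * (\<integral>\<^sup>+z. (\<Prod>j\<in>J. ennreal (exp (- s * indicator (E j) (z j)))) \<partial>Pi\<^sub>M J \<mu>)"
    proof (rule nn_integral_cmult)
      have "(\<lambda>v. ennreal (exp (- s * indicator (E j) v))) \<in> borel_measurable (\<mu> j)" if "j \<in> J" for j
        using E[OF that] by measurable
      then show "(\<lambda>z. \<Prod>j\<in>J. ennreal (exp (- s * indicator (E j) (z j)))) \<in> borel_measurable (Pi\<^sub>M J \<mu>)"
        by (intro borel_measurable_prod_ennreal measurable_compose[OF measurable_component_singleton])
    qed
    also have "(\<integral>\<^sup>+z. (\<Prod>j\<in>J. ennreal (exp (- s * indicator (E j) (z j)))) \<partial>Pi\<^sub>M J \<mu>)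
        = (\<Prod>j\<in>J. \<integral>\<^sup>+v. ennreal (exp (- s * indicator (E j) v)) \<partial>\<mu> j)"
    proof (rule P.product_nn_integral_prod[OF fin(2)])
      fix j assume "j \<in> J"
      from E[OF this] show "(\<lambda>v. ennreal (exp (- s * indicator (E j) v))) \<in> borel_measurable (\<mu> j)"
        by measurable
    qed
    also have "\<dots> \<le> (\<Prod>j\<in>J. ennreal (exp (- (1 - exp (- s)) * measure (\<mu> j) {A \<in> space N. Q A w > \<alpha>})))"
      by (intro prod_mono_ennreal mu.nn_integral_exp_indicator_le E s pE)
    also have "\<dots> = ennreal (exp (- (1 - exp (- s)) * (\<Sum>j\<in>J. measure (\<mu> j) {A \<in> space N. Q A w > \<alpha>})))"
      using fin by (simp add: prod_ennreal exp_sum sum_distrib_left)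
    also have "\<dots> \<le> ennreal (exp (- (1 - exp (- s)) * (b - real (card I))))"
    proof -
      let ?p = "\<lambda>i. measure (\<mu> i) {A \<in> space N. Q A w > \<alpha>}"
      have "b \<le> sum ?p K" by (rule tail[OF w])
      also have "\<dots> = sum ?p I + sum ?p J"
        using sum.union_disjoint[OF fin IJ(1), of ?p] unfolding IJ(2) .
      also have "sum ?p I \<le> (\<Sum>i\<in>I. 1)"
        by (intro sum_mono mu.prob_le_1)
      finally have "b - real (card I) \<le> sum ?p J" by simp
      then have "(1 - exp (- s)) * (b - real (card I)) \<le> (1 - exp (- s)) * sum ?p J"
        using s by (intro mult_left_mono) auto
      then show ?thesis by (intro ennreal_leI) (simp only: exp_le_cancel_iff mult_minus_left neg_le_iff_le)
    qed
    finally have "(\<integral>\<^sup>+z. F (merge I J (x, z)) \<partial>Pi\<^sub>M J \<mu>)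
        \<le> ennreal (exp (s * \<kappa>)) * ennreal (exp (- (1 - exp (- s)) * (b - real (card I))))"
      by (simp add: mult_left_mono)
    also have "\<dots> = ?R" by (simp add: ennreal_mult[symmetric] exp_add[symmetric] algebra_simps)
    finally show ?thesis .
  qed
  have "emeasure (Pi\<^sub>M K \<mu>) ?G = (\<integral>\<^sup>+A. indicator ?G A \<partial>Pi\<^sub>M K \<mu>)"
    using G by simp
  also have "\<dots> \<le> (\<integral>\<^sup>+A. F A \<partial>Pi\<^sub>M K \<mu>)" by (intro nn_integral_mono le)
  also have "\<dots> = (\<integral>\<^sup>+x. (\<integral>\<^sup>+y. F (merge I J (x, y)) \<partial>Pi\<^sub>M J \<mu>) \<partial>Pi\<^sub>M I \<mu>)"
    using P.product_nn_integral_fold[OF IJ(1) fin, of F] mF by (simp add: IJ)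
  also have "\<dots> \<le> (\<integral>\<^sup>+x. ?R \<partial>Pi\<^sub>M I \<mu>)" by (intro nn_integral_mono inner)
  also have "\<dots> = ?R"
  proof -
    have "prob_space (Pi\<^sub>M I \<mu>)" by (intro prob_space_PiM \<mu>)
    from prob_space.emeasure_space_1[OF this] show ?thesis by simp
  qed
  finally show "emeasure (Pi\<^sub>M K \<mu>) ?G \<le> ?R" .
qed

text \<open>The deterministic half of the argument: for every \<open>j\<close> in the set \<open>B\<close> of constraints that \<open>w\<close> satisfies, the distance
for \<open>insert j I\<close> lies between those for \<open>I\<close> and for \<open>B\<close>, which agree.\<close>

lemma small_form_gives_few_increases:
  assumes K: "finite K" "\<forall>i\<in>K. A i \<in> space N" and a: "a \<ge> 0"
    and w: "w \<in> coord_space d" "coord_norm d (w - u) \<le> \<delta>"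
    and few: "real (card {i \<in> K. Q (A i) w > a}) \<le> \<kappa>"
  obtains I where "I \<subseteq> K" "card I \<le> d + 1" "feas_dist a u I A \<le> \<delta>"
    "real (card {j \<in> K - I. feas_dist a u I A < feas_dist a u (insert j I) A}) \<le> \<kappa>"
proof -
  define B where "B = {i \<in> K. Q (A i) w \<le> a}"
  have B: "finite B" "B \<subseteq> K" "\<forall>i\<in>B. A i \<in> space N" using K by (auto simp: B_def)
  obtain I where I: "I \<subseteq> B" "card I \<le> d + 1" "feas_dist a u I A = feas_dist a u B A"
    using feas_dist_compression[OF B(1,3) a] .
  have "w \<in> feasible a B A" using w by (auto simp: feasible_def B_def)
  from feas_dist_le[OF this, of u] w I have D: "feas_dist a u I A \<le> \<delta>" by simp
  have "\<not> feas_dist a u I A < feas_dist a u (insert j I) A" if "j \<in> B" for j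
    using feas_dist_mono[OF B(3) a, of "insert j I" u] I that by auto
  then have "{j \<in> K - I. feas_dist a u I A < feas_dist a u (insert j I) A} \<subseteq> {i \<in> K. Q (A i) w > a}"
    by (force simp: B_def)
  then have "card {j \<in> K - I. feas_dist a u I A < feas_dist a u (insert j I) A} \<le> card {i \<in> K. Q (A i) w > a}"
    using K by (intro card_mono) auto
  with few have "real (card {j \<in> K - I. feas_dist a u I A < feas_dist a u (insert j I) A}) \<le> \<kappa>" by linarith
  then show thesis using that[of I] I B D by blast
qed

end

section \<open>A uniform lower tail bound for random quadratic forms\<close>

lemma card_above_le:
  fixes q :: "'i \<Rightarrow> real"
  assumes K: "finite K" and q: "\<And>i. i \<in> K \<Longrightarrow> 0 \<le> q i" and a: "a \<ge> 0" and \<kappa>: "\<kappa> \<ge> 0"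
    and s: "sum q K \<le> a * \<kappa>"
  shows "real (card {i \<in> K. q i > a}) \<le> \<kappa>"
proof (cases "a = 0")
  case True
  then have "sum q K = 0" using s sum_nonneg[of K q] q by simp
  then have "{i \<in> K. q i > a} = {}" using K q True by (auto simp: sum_nonneg_eq_0_iff)
  then have "card {i \<in> K. q i > a} = 0" by (simp only: card.empty)
  then show ?thesis using \<kappa> by simp
next
  case False
  have "a * real (card {i \<in> K. q i > a}) = (\<Sum>i\<in>{i \<in> K. q i > a}. a)" by simp
  also have "\<dots> \<le> (\<Sum>i\<in>{i \<in> K. q i > a}. q i)" by (intro sum_mono) auto
  also have "\<dots> \<le> sum q K" using K q by (intro sum_mono2) auto
  also note s
  finally show ?thesis using a False by simp
qed

text \<open>The logarithm of the left-hand side, with \<open>T = n * \<beta>\<close> and \<open>Y = m * ln (2 / \<beta>)\<close>. The net contributes at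
most \<open>72 * Y\<close>, the index sets \<open>T / 200 + 24 * Y\<close>, and the Chernoff bound with parameter \<open>1/4\<close> contributes
\<open>T / 6 - 9/41 * (T - 6 * Y)\<close>. Since \<open>9/41 - 1/6 > 1/20\<close>, the terms in \<open>T\<close> alone sum to less than
\<open>- T / 25\<close>, and the hypothesis \<open>Y \<le> T / 10000\<close> makes the terms in \<open>Y\<close> much smaller than that.\<close>

lemma union_bound_arith:
  fixes m d :: nat and T \<beta> :: real
  assumes \<beta>: "0 < \<beta>" "\<beta> \<le> 1" and m: "m > 0" and d: "d \<le> 2 * m"
    and T: "T \<ge> 10000 * real m * ln (2 / \<beta>)"
  shows "(3 ^ d * 2 ^ (16 * d)) * exp (T / 200 + real (d + 1) * ln (1 / (\<beta> / 200))) *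
      exp (1 / 4 * (2 / 3 * T) - (1 - exp (- (1 / 4))) * (T - real (d + 1))) \<le> exp (- (T / 10000))"
proof -
  define L where "L = ln (2 / \<beta>)"
  have L2: "ln 2 \<le> L" unfolding L_def using \<beta> by (subst ln_le_cancel_iff) (auto simp: field_simps)
  have L: "L \<ge> 1 / 2" using L2 ln2_ge_two_thirds by linarith
  define Y where "Y = real m * L"
  have mY: "real m \<le> 2 * Y"
    using mult_left_mono[OF L, of "real m"] by (simp add: Y_def)
  have T': "Y \<le> T / 10000" using T by (simp add: Y_def L_def)
  have Y0: "Y \<ge> 0" using mY by linarith
  have d3: "real (d + 1) \<le> 3 * real m" using d m by simp
  have "(3::real) ^ d * 2 ^ (16 * d) \<le> exp 2 ^ d * exp 1 ^ (16 * d)"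
    using exp_ge_add_one_self[of 2] exp_ge_add_one_self[of 1]
    by (intro mult_mono power_mono) auto
  also have "\<dots> = exp (18 * real d)"
    by (simp flip: exp_of_nat2_mult exp_add)
  also have "\<dots> \<le> exp (72 * Y)" using d mY by simp
  finally have 1: "(3::real) ^ d * 2 ^ (16 * d) \<le> exp (72 * Y)" .
  have "ln (1 / (\<beta> / 200)) = ln (100 * (2 / \<beta>))" by simp
  also have "\<dots> = ln 100 + L" unfolding L_def using \<beta> by (subst ln_mult) auto
  also have "ln (100::real) \<le> ln (2 ^ 7)" by (subst ln_le_cancel_iff) auto
  also have "ln ((2::real) ^ 7) = 7 * ln 2" by (subst ln_realpow) auto
  finally have l8: "ln (1 / (\<beta> / 200)) \<le> 8 * L" using L2 by simp
  have "real (d + 1) * ln (1 / (\<beta> / 200)) \<le> real (d + 1) * (8 * L)"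
    using l8 by (intro mult_left_mono) auto
  also have "\<dots> \<le> (3 * real m) * (8 * L)" using d3 L by (intro mult_right_mono) auto
  finally have 2: "real (d + 1) * ln (1 / (\<beta> / 200)) \<le> 24 * Y" by (simp add: Y_def)
  have "41 / 32 \<le> exp (1 / 4 :: real)"
    using exp_lower_Taylor_quadratic[of "1 / 4 :: real"] by (simp add: power2_eq_square)
  then have e: "9 / 41 \<le> 1 - exp (- (1 / 4) :: real)" by (simp add: exp_minus field_simps)
  have Td: "T - real (d + 1) \<ge> T - 6 * Y" using d3 mY by linarith
  have "T - real (d + 1) \<ge> 0" using Td T' Y0 by linarith
  then have "9 / 41 * (T - real (d + 1)) \<le> (1 - exp (- (1 / 4))) * (T - real (d + 1))"
    using e by (intro mult_right_mono)
  moreover have "9 / 41 * (T - 6 * Y) \<le> 9 / 41 * (T - real (d + 1))"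
    using Td by (intro mult_left_mono) auto
  ultimately have 3: "9 / 41 * (T - 6 * Y) \<le> (1 - exp (- (1 / 4))) * (T - real (d + 1))"
    by (rule order_trans[rotated])
  have "(3 ^ d * 2 ^ (16 * d)) * exp (T / 200 + real (d + 1) * ln (1 / (\<beta> / 200))) *
      exp (1 / 4 * (2 / 3 * T) - (1 - exp (- (1 / 4))) * (T - real (d + 1)))
    \<le> exp (72 * Y) * exp (T / 200 + 24 * Y) * exp (1 / 4 * (2 / 3 * T) - 9 / 41 * (T - 6 * Y))"
    using 2 3 by (intro mult_mono 1) auto
  also have "\<dots> = exp (72 * Y + (T / 200 + 24 * Y) + (1 / 4 * (2 / 3 * T) - 9 / 41 * (T - 6 * Y)))"
    by (simp only: exp_add)
  also have "72 * Y + (T / 200 + 24 * Y) + (1 / 4 * (2 / 3 * T) - 9 / 41 * (T - 6 * Y)) \<le> - (T / 10000)"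
    using T' Y0 by (simp add: field_simps)
  finally show ?thesis by simp
qed

text \<open>The union bound. The event \<open>F\<close> is the union, over the net points \<open>u\<close> and the index sets \<open>I\<close> of at most \<open>d + 1\<close> elements,
of the events bounded in \<open>prob_few_increases\<close> with \<open>\<delta> = 1/16\<close>. The level \<open>a\<close> is then \<open>49/64 * \<alpha>\<close>, and a form
sum of at most \<open>n\<alpha>\<beta>/2\<close> leaves at most \<open>32/49 * n\<beta> \<le> 2/3 * n\<beta>\<close> forms above this level.\<close>

lemma (in psd_forms) uniform_lower_tail:
  fixes P :: "'w measure" and X :: "nat \<Rightarrow> 'w \<Rightarrow> 'a" and n m :: nat
  assumes P: "prob_space P" and ind: "prob_space.indep_vars P (\<lambda>_. N) X {1..n}"
    and n: "n > 0" and m: "m > 0" and d: "d > 0" "d \<le> 2 * m"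
    and \<alpha>: "\<alpha> \<ge> 0" and \<beta>: "0 < \<beta>" "\<beta> \<le> 1"
    and tail: "\<And>y. y \<in> coord_space d \<Longrightarrow> coord_norm d y = 1 \<Longrightarrow>
        real n * \<beta> \<le> (\<Sum>i=1..n. measure P {\<omega> \<in> space P. Q (X i \<omega>) y > \<alpha>})"
    and large: "real n \<ge> 10000 * real m / \<beta> * ln (2 / \<beta>)"
  obtains F where "F \<in> sets P" "measure P F \<le> exp (- (real n * \<beta> / 10000))"
    "\<And>\<omega> w. \<omega> \<in> space P \<Longrightarrow> w \<in> coord_space d \<Longrightarrow> coord_norm d w = 1 \<Longrightarrow>
       (\<Sum>i=1..n. Q (X i \<omega>) w) \<le> real n * \<alpha> * \<beta> / 2 \<Longrightarrow> \<omega> \<in> F"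
proof -
  interpret P: prob_space P by fact
  define K where "K = {1..n}"
  have K: "finite K" "card K = n" "1 \<in> K" using n by (auto simp: K_def)
  have X: "X i \<in> measurable P N" if "i \<in> K" for i
    using ind that unfolding P.indep_vars_def K_def by auto
  \<comment> \<open>A product probability space is indexed by a whole type; outside of K any law will do.\<close>
  define \<mu> where "\<mu> i = distr P N (X (if i \<in> K then i else 1))" for i
  have \<mu>: "prob_space (\<mu> i)" "sets (\<mu> i) = sets N" for i
    unfolding \<mu>_def using K by (auto intro!: P.prob_space_distr X)
  define Z where "Z \<omega> = (\<lambda>i\<in>K. X i \<omega>)" for \<omega>
  have Z: "Z \<in> measurable P (Pi\<^sub>M K (\<lambda>_. N))"
    unfolding Z_def by (intro measurable_restrict X)
  have setsPi: "sets (Pi\<^sub>M K \<mu>) = sets (Pi\<^sub>M K (\<lambda>_. N))"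
    by (intro sets_PiM_cong \<mu> refl)
  have law: "distr P (Pi\<^sub>M K (\<lambda>_. N)) Z = Pi\<^sub>M K \<mu>"
  proof -
    have "distr P (Pi\<^sub>M K (\<lambda>_. N)) (\<lambda>\<omega>. \<lambda>i\<in>K. X i \<omega>) = Pi\<^sub>M K (\<lambda>i. distr P N (X i))"
      using P.indep_vars_iff_distr_eq_PiM'[where I = K and M' = "\<lambda>_. N" and X = X] X K ind by (auto simp: K_def)
    also have "\<dots> = Pi\<^sub>M K \<mu>" by (intro PiM_cong) (auto simp: \<mu>_def)
    finally show ?thesis by (simp add: Z_def[abs_def])
  qed
  define T where "T = real n * \<beta>"
  define a where "a = (1 - 2 * (1 / 16))\<^sup>2 * \<alpha>"
  have a0: "a \<ge> 0" using \<alpha> by (simp add: a_def)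
  have T0: "T \<ge> 0" using \<beta> by (simp add: T_def)
  have mtail: "T \<le> (\<Sum>i\<in>K. measure (\<mu> i) {A \<in> space N. Q A y > \<alpha>})"
    if y: "y \<in> coord_space d" "coord_norm d y = 1" for y
  proof -
    have "measure (\<mu> i) {A \<in> space N. Q A y > \<alpha>} = measure P {\<omega> \<in> space P. Q (X i \<omega>) y > \<alpha>}" if i: "i \<in> K" for i
    proof -
      have [measurable]: "(\<lambda>A. Q A y) \<in> borel_measurable N" by (rule Q_measurable)
      have "measure (\<mu> i) {A \<in> space N. Q A y > \<alpha>} = measure P (X i -` {A \<in> space N. Q A y > \<alpha>} \<inter> space P)"
        using i unfolding \<mu>_def by (simp add: measure_distr[OF X])
      also have "X i -` {A \<in> space N. Q A y > \<alpha>} \<inter> space P = {\<omega> \<in> space P. Q (X i \<omega>) y > \<alpha>}"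
        using measurable_space[OF X[OF i]] by auto
      finally show ?thesis .
    qed
    then show ?thesis using tail[OF y] by (simp add: T_def K_def)
  qed
  obtain U where U: "finite U" "U \<subseteq> coord_space d" "real (card U) \<le> 3 ^ d * 2 ^ (16 * d)"
    "\<And>x. x \<in> coord_space d \<Longrightarrow> coord_norm d x = 1 \<Longrightarrow> \<exists>u\<in>U. coord_norm d (x - u) \<le> 1 / 16"
    using sphere_net[OF d(1), of 16] by auto
  \<comment> \<open>Only net points of norm at least \<open>1 - 1/16\<close> can be within \<open>1/16\<close> of a unit vector.\<close>
  define V where "V = {u \<in> U. coord_norm d u \<ge> 1 - 1 / 16}"
  define \<I> where "\<I> = {I. I \<subseteq> K \<and> card I \<le> d + 1}"
  define G where "G u I = {A \<in> space (Pi\<^sub>M K \<mu>). feas_dist a u I A \<le> 1 / 16 \<and>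
        real (card {j \<in> K - I. feas_dist a u I A < feas_dist a u (insert j I) A}) \<le> 2 / 3 * T}" for u I
  define b where "b = exp (1 / 4 * (2 / 3 * T) - (1 - exp (- (1 / 4))) * (T - real (d + 1)))"
  have fin: "finite (V \<times> \<I>)" using U(1) K by (auto simp: V_def \<I>_def)
  have G: "G u I \<in> sets (Pi\<^sub>M K \<mu>)" "measure P (Z -` G u I \<inter> space P) \<le> b" if ui: "u \<in> V" "I \<in> \<I>" for u I
  proof -
    have I: "I \<subseteq> K" "card I \<le> d + 1" and u: "coord_norm d u \<ge> 1 - 1 / 16"
      using ui by (auto simp: V_def \<I>_def)
    note few = prob_few_increases[OF \<mu> K(1) I(1) \<alpha> _ _ u _ mtail, of "1 / 4" "2 / 3 * T", folded a_def]
    show sG: "G u I \<in> sets (Pi\<^sub>M K \<mu>)" unfolding G_def by (rule few) auto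
    have "emeasure (Pi\<^sub>M K \<mu>) (G u I) \<le> ennreal (exp (1 / 4 * (2 / 3 * T) - (1 - exp (- (1 / 4))) * (T - real (card I))))"
      unfolding G_def by (rule few) auto
    also have "\<dots> \<le> ennreal b"
      unfolding b_def using I(2) by (intro ennreal_leI) (auto intro!: mult_left_mono)
    finally have "emeasure (distr P (Pi\<^sub>M K (\<lambda>_. N)) Z) (G u I) \<le> ennreal b" by (simp add: law)
    also have "emeasure (distr P (Pi\<^sub>M K (\<lambda>_. N)) Z) (G u I) = emeasure P (Z -` G u I \<inter> space P)"
      using sG setsPi by (intro emeasure_distr Z) auto
    finally show "measure P (Z -` G u I \<inter> space P) \<le> b"
      by (simp add: P.emeasure_eq_measure b_def)
  qed
  define F where "F = (\<Union>(u, I)\<in>V \<times> \<I>. Z -` G u I \<inter> space P)"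
  show thesis
  proof (rule that[of F])
    have sets: "Z -` G u I \<inter> space P \<in> sets P" if "u \<in> V" "I \<in> \<I>" for u I
      using G(1)[OF that] setsPi by (intro measurable_sets[OF Z]) auto
    then show "F \<in> sets P" unfolding F_def using fin by auto
    have "measure P F \<le> (\<Sum>(u, I)\<in>V \<times> \<I>. measure P (Z -` G u I \<inter> space P))"
      unfolding F_def split_def using sets
      by (intro P.finite_measure_subadditive_finite[OF fin]) auto
    also have "\<dots> \<le> (\<Sum>(u, I)\<in>V \<times> \<I>. b)"
      by (intro sum_mono) (auto intro: G)
    also have "\<dots> = real (card V) * real (card \<I>) * b"
      by (simp add: card_cartesian_product)
    also have "\<dots> \<le> (3 ^ d * 2 ^ (16 * d)) * exp (T / 200 + real (d + 1) * ln (1 / (\<beta> / 200))) * b"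
    proof -
      have "card V \<le> card U" using U(1) by (intro card_mono) (auto simp: V_def)
      then have cV: "real (card V) \<le> 3 ^ d * 2 ^ (16 * d)" using U(3) by linarith
      have "real (card \<I>) \<le> exp (real (card K) * (\<beta> / 200) + real (d + 1) * ln (1 / (\<beta> / 200)))"
        unfolding \<I>_def using \<beta> by (intro card_bounded_subsets_le K) auto
      then have cI: "real (card \<I>) \<le> exp (T / 200 + real (d + 1) * ln (1 / (\<beta> / 200)))"
        by (simp add: K T_def)
      show ?thesis by (intro mult_mono cV cI) (auto simp: b_def)
    qed
    also have "\<dots> \<le> exp (- (T / 10000))"
      unfolding b_def using large \<beta> by (intro union_bound_arith[OF \<beta> m d(2)]) (simp add: T_def field_simps)
    finally show "measure P F \<le> exp (- (real n * \<beta> / 10000))" by (simp add: T_def)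
  next
    fix \<omega> w assume \<omega>: "\<omega> \<in> space P" and w: "w \<in> coord_space d" "coord_norm d w = 1"
      and small: "(\<Sum>i=1..n. Q (X i \<omega>) w) \<le> real n * \<alpha> * \<beta> / 2"
    have XN: "\<forall>i\<in>K. Z \<omega> i \<in> space N"
      using measurable_space[OF X] \<omega> by (auto simp: Z_def)
    obtain u where u: "u \<in> U" "coord_norm d (w - u) \<le> 1 / 16" using U(4)[OF w] by auto
    have "coord_norm d w \<le> coord_norm d (w - u) + coord_norm d u"
      using coord_norm_triangle[of "w - u" u d] by simp
    then have uV: "u \<in> V" using u w by (simp add: V_def)
    have few: "real (card {i \<in> K. Q (Z \<omega> i) w > a}) \<le> 2 / 3 * T"
    proof (rule card_above_le[OF K(1) _ a0])
      have "(\<Sum>i\<in>K. Q (Z \<omega> i) w) = (\<Sum>i=1..n. Q (X i \<omega>) w)"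
        unfolding K_def by (intro sum.cong) (auto simp: Z_def K_def)
      also note small
      also have "real n * \<alpha> * \<beta> / 2 = \<alpha> * T / 2" by (simp add: T_def)
      also have "\<dots> \<le> a * (2 / 3 * T)"
      proof -
        have "0 \<le> \<alpha> * T" using \<alpha> T0 by simp
        then show ?thesis by (simp add: a_def power2_eq_square mult.commute)
      qed
      finally show "(\<Sum>i\<in>K. Q (Z \<omega> i) w) \<le> a * (2 / 3 * T)" .
    qed (use XN T0 Q_nonneg in auto)
    obtain I where I: "I \<subseteq> K" "card I \<le> d + 1" "feas_dist a u I (Z \<omega>) \<le> 1 / 16"
      "real (card {j \<in> K - I. feas_dist a u I (Z \<omega>) < feas_dist a u (insert j I) (Z \<omega>)}) \<le> 2 / 3 * T"
      using small_form_gives_few_increases[OF K(1) XN a0 w(1) u(2) few] .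
    have "Z \<omega> \<in> space (Pi\<^sub>M K \<mu>)"
      using measurable_space[OF Z \<omega>] sets_eq_imp_space_eq[OF setsPi] by simp
    then have "Z \<omega> \<in> G u I" using I by (simp add: G_def)
    then show "\<omega> \<in> F" using uV I \<omega> by (auto simp: F_def \<I>_def)
  qed
qed

section \<open>Hermitian forms and singular values in real coordinates\<close>

text \<open>The common properties of the real and the complex numbers: \<open>coord y k\<close> is the \<open>k\<close>-th entry of the vector over the scalar
field with real coordinates \<open>y\<close>, and \<open>r\<close> is the real dimension of the field. The last assumption
expresses that the singular values of an \<open>m \<times> m\<close> matrix are \<open>m\<close> in number.\<close>

locale scalar_coords =
  fixes re :: "'a::{conjugatable_ordered_field, real_normed_field} \<Rightarrow> real"
    and coord :: "(nat \<Rightarrow> real) \<Rightarrow> nat \<Rightarrow> 'a"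
    and r :: nat
  assumes re_linear: "bounded_linear re"
    and re_le_norm: "re z \<le> norm z"
    and nonneg_real: "0 \<le> z \<Longrightarrow> z = of_real (re z) \<and> 0 \<le> re z"
    and of_real_less: "of_real s < (of_real t :: 'a) \<longleftrightarrow> s < t"
    and conjugate_linear: "bounded_linear (conjugate :: 'a \<Rightarrow> 'a)"
    and times_conjugate: "z * conjugate z = of_real ((norm z)\<^sup>2)"
    and coord_comb: "coord (s *\<^sub>R x + t *\<^sub>R y) k = s *\<^sub>R coord x k + t *\<^sub>R coord y k"
    and coord_continuous: "continuous_on UNIV (\<lambda>y. coord y k)"
    and coord_norm: "(\<Sum>k<m. (norm (coord y k))\<^sup>2) = (\<Sum>i<r * m. (y i)\<^sup>2)"
    and coord_surj: "\<exists>y\<in>coord_space (r * m). \<forall>k<m. coord y k = v k"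
    and r: "0 < r" "r \<le> 2"
    and char_poly_splits: "(A :: 'a mat) \<in> carrier_mat m m \<Longrightarrow> size (proots (char_poly (mat_adjoint A * A))) = m"
begin

text \<open>The real part of \<open>x\<^sup>* A x\<close> for the vector \<open>x\<close> with real coordinates \<open>y\<close>. Written as a sum over entries it is visibly
continuous in \<open>y\<close> and measurable in \<open>A\<close>.\<close>

definition form :: "nat \<Rightarrow> 'a mat \<Rightarrow> (nat \<Rightarrow> real) \<Rightarrow> real" where
  "form m A y = (\<Sum>k<m. \<Sum>l<m. re (A $$ (k, l) * coord y l * conjugate (coord y k)))"

lemma re_sum: "re (\<Sum>i\<in>I. f i) = (\<Sum>i\<in>I. re (f i))"
  by (rule linear_sum[OF bounded_linear.linear[OF re_linear]])

lemma re_scale: "re (t *\<^sub>R z) = t * re z"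
  using linear_scale[OF bounded_linear.linear[OF re_linear], of t z] by simp

lemma conjugate_scale: "conjugate (t *\<^sub>R z) = t *\<^sub>R conjugate (z :: 'a)"
  by (rule linear_scale[OF bounded_linear.linear[OF conjugate_linear]])

lemma form_eq:
  assumes A: "A \<in> carrier_mat m m"
  shows "form m A y = re ((A *\<^sub>v vec m (coord y)) \<bullet>c vec m (coord y))"
  using A by (auto simp: form_def scalar_prod_def re_sum sum_distrib_right atLeast0LessThan row_def
      intro!: sum.cong)

lemma coord_scale: "coord (t *\<^sub>R y) k = t *\<^sub>R coord y k"
  using coord_comb[of t y 0 0 k] by simp

lemma form_scale: "form m A (t *\<^sub>R y) = t\<^sup>2 * form m A y"
  by (simp add: form_def coord_scale conjugate_scale re_scale sum_distrib_left power2_eq_square mult_ac)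

text \<open>The convexity defect of a quadratic form is again a value of the form, so a positive semidefinite form is convex.\<close>

lemma form_comb:
  assumes st: "s + t = 1"
  shows "form m A (s *\<^sub>R x + t *\<^sub>R y) = s * form m A x + t * form m A y - s * t * form m A (x - y)"
proof -
  have t: "t = 1 - s" using st by simp
  have d: "coord (x - y) k = coord x k - coord y k" for k
    using coord_comb[of 1 x "-1" y k] by simp
  have "re (a * coord (s *\<^sub>R x + t *\<^sub>R y) l * conjugate (coord (s *\<^sub>R x + t *\<^sub>R y) k))
      = s * re (a * coord x l * conjugate (coord x k)) + t * re (a * coord y l * conjugate (coord y k))
        - s * t * re (a * coord (x - y) l * conjugate (coord (x - y) k))" for a k l
  proof -
    have c: "conjugate (z - w) = conjugate z - conjugate w" for z w :: 'a
      by (rule linear_diff[OF bounded_linear.linear[OF conjugate_linear]])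
    have "a * coord (s *\<^sub>R x + t *\<^sub>R y) l * conjugate (coord (s *\<^sub>R x + t *\<^sub>R y) k)
      = s *\<^sub>R (a * coord x l * conjugate (coord x k)) + t *\<^sub>R (a * coord y l * conjugate (coord y k))
        - (s * t) *\<^sub>R (a * coord (x - y) l * conjugate (coord (x - y) k))"
      unfolding coord_comb d c conjugate_dist_add conjugate_scale t
      by (simp add: scaleR_conv_of_real algebra_simps)
    then show ?thesis
      by (simp only: re_scale linear_add[OF bounded_linear.linear[OF re_linear]] linear_diff[OF bounded_linear.linear[OF re_linear]])
  qed
  then show ?thesis
    by (simp add: form_def sum.distrib sum_subtractf sum_distrib_left)
qed

text \<open>Restricting the Borel structure to the positive semidefinite matrices makes the product spaces of random matrices
consist of such matrices only, so that no null sets have to be discussed.\<close>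

definition psd_space :: "nat \<Rightarrow> 'a mat measure" where
  "psd_space m = restrict_space (borel_mat m) {A. psd_mat m A}"

lemma space_borel_mat: "space (borel_mat m) = carrier_mat m m"
  by (simp add: borel_mat_def space_vimage_algebra)

lemma space_psd_space: "space (psd_space m) = {A. psd_mat m A}"
  by (auto simp: psd_space_def space_restrict_space space_borel_mat psd_mat_def)

lemma form_nonneg: "psd_mat m A \<Longrightarrow> 0 \<le> form m A y"
  using nonneg_real[of "(A *\<^sub>v vec m (coord y)) \<bullet>c vec m (coord y)"]
  by (auto simp: psd_mat_def form_eq)

lemma entry_measurable:
  assumes "k < m" "l < m"
  shows "(\<lambda>A. A $$ (k, l)) \<in> measurable (borel_mat m :: 'a mat measure) borel"
proof -
  let ?g = "\<lambda>A::'a mat. \<lambda>p\<in>{..<m} \<times> {..<m}. A $$ p"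
  have "?g \<in> measurable (borel_mat m) (\<Pi>\<^sub>M p\<in>{..<m} \<times> {..<m}. borel)"
    unfolding borel_mat_def by (rule measurable_vimage_algebra1) (auto simp: space_PiM)
  then have "(\<lambda>A. ?g A (k, l)) \<in> measurable (borel_mat m) borel"
    using assms by (intro measurable_compose[of ?g, OF _ measurable_component_singleton]) auto
  then show ?thesis using assms by simp
qed

sublocale psd: psd_forms "psd_space m" "form m" "r * m" for m
proof
  fix y :: "nat \<Rightarrow> real"
  have entry: "(\<lambda>A. re (A $$ (k, l) * coord y l * conjugate (coord y k))) \<in> borel_measurable (borel_mat m)"
    if "k < m" "l < m" for k l
  proof (rule measurable_compose[OF entry_measurable[OF that]])
    show "(\<lambda>z. re (z * coord y l * conjugate (coord y k))) \<in> borel_measurable borel"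
      by (intro borel_measurable_continuous_onI linear_continuous_on_compose
          bounded_linear.continuous_on[OF re_linear] continuous_intros)
  qed
  have "(\<lambda>A. form m A y) \<in> borel_measurable (borel_mat m)"
    unfolding form_def by (intro borel_measurable_sum entry) auto
  then show "(\<lambda>A. form m A y) \<in> borel_measurable (psd_space m)"
    unfolding psd_space_def by (rule measurable_restrict_space1)
next
  fix A :: "'a mat"
  show "continuous_on UNIV (form m A)"
    unfolding form_def
    by (intro continuous_intros bounded_linear.continuous_on[OF re_linear]
        bounded_linear.continuous_on[OF conjugate_linear] coord_continuous)
  fix t y show "form m A (t *\<^sub>R y) = t\<^sup>2 * form m A y" by (rule form_scale)
  assume "A \<in> space (psd_space m)"
  then have A: "psd_mat m A" by (simp add: space_psd_space)
  show "0 \<le> form m A y" by (rule form_nonneg[OF A])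
  show "convex_on UNIV (form m A)"
    unfolding convex_on_def
  proof (intro conjI ballI allI impI)
    fix x y :: "nat \<Rightarrow> real" and s t :: real
    assume st: "0 \<le> s" "0 \<le> t" "s + t = 1"
    have "0 \<le> s * t * form m A (x - y)" using st form_nonneg[OF A] by simp
    then show "form m A (s *\<^sub>R x + t *\<^sub>R y) \<le> s * form m A x + t * form m A y"
      unfolding form_comb[OF st(3)] by simp
  qed simp
qed

lemma vec_norm: "vec m (coord y) \<bullet>c vec m (coord y) = of_real ((coord_norm (r * m) y)\<^sup>2)"
proof -
  have "vec m (coord y) \<bullet>c vec m (coord y) = of_real (\<Sum>k<m. (norm (coord y k))\<^sup>2)"
    by (simp add: scalar_prod_def times_conjugate atLeast0LessThan)
  then show ?thesis by (simp add: coord_norm L2_set_def sum_nonneg)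
qed

lemma cscalar_self: "w \<bullet>c w = of_real ((L2_set (\<lambda>k. norm (w $ k)) {..<dim_vec w})\<^sup>2)" for w :: "'a vec"
  by (simp add: scalar_prod_def times_conjugate atLeast0LessThan L2_set_def sum_nonneg)

lemma mat_adjoint_index:
  "i < dim_col A \<Longrightarrow> j < dim_row A \<Longrightarrow> mat_adjoint A $$ (i, j) = conjugate (A $$ (j, i))" for A :: "'a mat"
  by (simp add: mat_adjoint_def mat_of_rows_index)

lemma mat_adjoint_carrier: "A \<in> carrier_mat m m \<Longrightarrow> mat_adjoint A \<in> carrier_mat m m" for A :: "'a mat"
  by (rule carrier_matI) (auto simp: mat_adjoint_def)

lemma adjoint_cscalar:
  fixes A :: "'a mat"
  assumes A: "A \<in> carrier_mat m m" and x: "x \<in> carrier_vec m"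
  shows "((mat_adjoint A * A) *\<^sub>v x) \<bullet>c x = (A *\<^sub>v x) \<bullet>c (A *\<^sub>v x)"
proof -
  have Aa: "mat_adjoint A \<in> carrier_mat m m" using A by (rule mat_adjoint_carrier)
  define w where "w = A *\<^sub>v x"
  have w: "w \<in> carrier_vec m" using A x by (simp add: w_def)
  have "((mat_adjoint A * A) *\<^sub>v x) \<bullet>c x = (mat_adjoint A *\<^sub>v w) \<bullet>c x"
    unfolding w_def using assoc_mult_mat_vec[OF Aa A x] by simp
  also have "\<dots> = (\<Sum>i<m. \<Sum>j<m. conjugate (A $$ (j, i)) * w $ j * conjugate (x $ i))"
    using A Aa w x by (simp add: scalar_prod_def mat_adjoint_index sum_distrib_right atLeast0LessThan)
  also have "\<dots> = (\<Sum>j<m. \<Sum>i<m. conjugate (A $$ (j, i)) * w $ j * conjugate (x $ i))"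
    by (rule sum.swap)
  also have "\<dots> = (\<Sum>j<m. w $ j * conjugate (\<Sum>i<m. A $$ (j, i) * x $ i))"
    by (simp add: sum_conjugate conjugate_dist_mul sum_distrib_left mult_ac)
  also have "\<dots> = w \<bullet>c w"
    using A x w by (simp add: scalar_prod_def atLeast0LessThan) (simp add: w_def scalar_prod_def atLeast0LessThan)
  finally show ?thesis by (simp add: w_def)
qed

lemma re_cscalar_le:
  fixes v w :: "'a vec"
  assumes "v \<in> carrier_vec m" "w \<in> carrier_vec m"
  shows "re (v \<bullet>c w) \<le> L2_set (\<lambda>k. norm (v $ k)) {..<m} * L2_set (\<lambda>k. norm (w $ k)) {..<m}"
proof -
  have nc: "norm (conjugate z) = norm z" for z :: 'a
  proof -
    have "of_real ((norm (conjugate z))\<^sup>2) = (of_real ((norm z)\<^sup>2) :: 'a)"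
      using times_conjugate[of z] times_conjugate[of "conjugate z"] by (simp add: mult.commute)
    then have "(norm (conjugate z))\<^sup>2 = (norm z)\<^sup>2" by (simp only: of_real_eq_iff)
    then show ?thesis by (metis norm_ge_zero power2_eq_iff_nonneg)
  qed
  have "re (v \<bullet>c w) \<le> norm (v \<bullet>c w)" by (rule re_le_norm)
  also have "\<dots> \<le> (\<Sum>k<m. norm (v $ k) * norm (w $ k))"
    using assms by (simp add: scalar_prod_def atLeast0LessThan)
      (auto intro!: sum_norm_le simp: norm_mult nc)
  also have "\<dots> \<le> L2_set (\<lambda>k. norm (v $ k)) {..<m} * L2_set (\<lambda>k. norm (w $ k)) {..<m}"
    using L2_set_mult_ineq[of "\<lambda>k. norm (v $ k)" "\<lambda>k. norm (w $ k)" "{..<m}"] by simp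
  finally show ?thesis .
qed

text \<open>The smallest singular value is \<open>sqrt z\<close> for an eigenvalue \<open>z\<close> of \<open>A\<^sup>* A\<close>. If \<open>x\<close> is a unit eigenvector, then
\<open>|A x|\<^sup>2 = z\<close>, and the claim is the Cauchy--Schwarz inequality for \<open>A x\<close> and \<open>x\<close>.\<close>

lemma unit_vector_sigma_val:
  assumes A: "A \<in> carrier_mat m m" and m: "m > 0"
  obtains x where "x \<in> carrier_vec m" "x \<bullet>c x = 1" "re ((A *\<^sub>v x) \<bullet>c x) \<le> sigma_val m A"
proof -
  let ?B = "mat_adjoint A * A"
  have B: "?B \<in> carrier_mat m m" using mat_adjoint_carrier[OF A] A by simp
  have "length (sorted_list_of_multiset X) = size X" for X :: "real multiset"
    by (metis mset_sorted_list_of_multiset size_mset)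
  then have len: "length (singular_values A) = m"
    using char_poly_splits[OF A] by (simp add: singular_values_def)
  have "sigma_val m A \<in> set (singular_values A)"
    unfolding sigma_val_def using len m by (intro nth_mem) simp
  then obtain z where z: "z \<in># proots (char_poly ?B)" "sigma_val m A = sqrt (norm z)"
    unfolding singular_values_def by auto
  have "char_poly ?B \<noteq> 0" using degree_monic_char_poly[OF B] by auto
  then have "poly (char_poly ?B) z = 0" using z(1) by simp
  then have "eigenvalue ?B z" using eigenvalue_root_char_poly[OF B] by simp
  then obtain v where v: "v \<in> carrier_vec m" "v \<noteq> 0\<^sub>v m" "?B *\<^sub>v v = z \<cdot>\<^sub>v v"
    unfolding eigenvalue_def eigenvector_def using B by auto
  define N where "N = L2_set (\<lambda>k. norm (v $ k)) {..<m}"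
  have vv: "v \<bullet>c v = of_real (N\<^sup>2)" using cscalar_self[of v] v(1) by (simp add: N_def)
  have N0: "N > 0"
  proof -
    have "N \<noteq> 0" using vv v conjugate_square_eq_0_vec[OF v(1)] by auto
    moreover have "N \<ge> 0" by (simp add: N_def)
    ultimately show ?thesis by simp
  qed
  define W where "W = L2_set (\<lambda>k. norm ((A *\<^sub>v v) $ k)) {..<m}"
  have Av: "A *\<^sub>v v \<in> carrier_vec m" using A v by simp
  have "of_real (W\<^sup>2) = (A *\<^sub>v v) \<bullet>c (A *\<^sub>v v)"
    using cscalar_self[of "A *\<^sub>v v"] Av A by (simp add: W_def)
  also have "\<dots> = z * of_real (N\<^sup>2)"
    using adjoint_cscalar[OF A v(1)] v by (simp add: vv)
  finally have "norm (of_real (W\<^sup>2) :: 'a) = norm (z * of_real (N\<^sup>2))" by simp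
  then have "W\<^sup>2 = norm z * N\<^sup>2" by (simp add: norm_mult norm_power)
  then have W: "W = sqrt (norm z) * N"
    using N0 by (metis W_def L2_set_nonneg abs_of_nonneg abs_of_pos real_sqrt_abs real_sqrt_mult)
  have le: "re ((A *\<^sub>v v) \<bullet>c v) \<le> sigma_val m A * N\<^sup>2"
    using re_cscalar_le[OF Av v(1)] unfolding N_def[symmetric] W_def[symmetric] W z(2)
    by (simp add: power2_eq_square mult.assoc)
  define x where "x = of_real (1 / N) \<cdot>\<^sub>v v"
  have cr: "conjugate (of_real t :: 'a) = of_real t" for t
  proof -
    have c1: "conjugate (1 :: 'a) = 1" using times_conjugate[of "1 :: 'a"] by simp
    show ?thesis using conjugate_scale[of t 1] by (simp add: of_real_def c1)
  qed
  have cx: "conjugate x = of_real (1 / N) \<cdot>\<^sub>v conjugate v"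
    unfolding x_def conjugate_smult_vec cr ..
  show thesis
  proof (rule that)
    show x: "x \<in> carrier_vec m" using v by (simp add: x_def)
    show "x \<bullet>c x = 1"
      unfolding cx unfolding x_def using v N0 vv
      by (simp add: scalar_prod_smult_distrib[of v m] smult_scalar_prod_distrib[of v m] power2_eq_square)
    have "(A *\<^sub>v x) \<bullet>c x = of_real (1 / N\<^sup>2) * ((A *\<^sub>v v) \<bullet>c v)"
      unfolding cx unfolding x_def using v N0 Av A
      by (simp add: mult_mat_vec[OF A v(1)] scalar_prod_smult_distrib[OF _ carrier_vec_conjugate[OF v(1)]]
          smult_scalar_prod_distrib[OF Av carrier_vec_conjugate[OF v(1)]] power2_eq_square)
    then have "re ((A *\<^sub>v x) \<bullet>c x) = (1 / N\<^sup>2) * re ((A *\<^sub>v v) \<bullet>c v)"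
      using re_scale[of "1 / N\<^sup>2" "(A *\<^sub>v v) \<bullet>c v"] by (simp only: scaleR_conv_of_real)
    also have "\<dots> \<le> (1 / N\<^sup>2) * (sigma_val m A * N\<^sup>2)"
      using le by (intro mult_left_mono) auto
    finally show "re ((A *\<^sub>v x) \<bullet>c x) \<le> sigma_val m A" using N0 by simp
  qed
qed

end

section \<open>The tail bound over one scalar field\<close>

context scalar_coords
begin

text \<open>On positive semidefinite values the restricted and the full Borel structure have the same preimages.\<close>

lemma indep_vars_psd_space:
  assumes P: "prob_space P" and ind: "prob_space.indep_vars P (\<lambda>_. borel_mat m) M I"
    and psd: "\<forall>i\<in>I. \<forall>\<omega>\<in>space P. psd_mat m (M i \<omega>)"
  shows "prob_space.indep_vars P (\<lambda>_. psd_space m) M I"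
proof -
  interpret P: prob_space P by fact
  have rv: "M i \<in> measurable P (psd_space m)" if "i \<in> I" for i
    using ind psd that unfolding psd_space_def P.indep_vars_def
    by (intro measurable_restrict_space2) auto
  have sub: "{M i -` B \<inter> space P | B. B \<in> sets (psd_space m)} \<subseteq> {M i -` B \<inter> space P | B. B \<in> sets (borel_mat m)}"
    if i: "i \<in> I" for i
  proof clarify
    fix B assume "B \<in> sets (psd_space m)"
    then obtain C where C: "C \<in> sets (borel_mat m)" "B = {A. psd_mat m A} \<inter> C"
      unfolding psd_space_def sets_restrict_space by auto
    have "M i -` B \<inter> space P = M i -` C \<inter> space P" using psd i C(2) by auto
    then show "\<exists>C. M i -` B \<inter> space P = M i -` C \<inter> space P \<and> C \<in> sets (borel_mat m)" using C(1) by blast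
  qed
  have "P.indep_sets (\<lambda>i. {M i -` B \<inter> space P | B. B \<in> sets (borel_mat m)}) I"
    using ind unfolding P.indep_vars_def2 by simp
  from P.indep_sets_mono_sets[OF this sub]
  have "P.indep_sets (\<lambda>i. {M i -` B \<inter> space P | B. B \<in> sets (psd_space m)}) I" .
  then show ?thesis using rv unfolding P.indep_vars_def2 by simp
qed

lemma form_mean_mat:
  assumes "n > 0"
  shows "(\<Sum>i=1..n. form m (A i) y) = real n * form m (mean_mat m n A) y"
proof -
  have "real n * re (mean_mat m n A $$ (k, l) * coord y l * conjugate (coord y k))
      = (\<Sum>i=1..n. re (A i $$ (k, l) * coord y l * conjugate (coord y k)))" if "k < m" "l < m" for k l
  proof -
    have "real n *\<^sub>R (mean_mat m n A $$ (k, l) * coord y l * conjugate (coord y k))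
        = (\<Sum>i=1..n. A i $$ (k, l) * coord y l * conjugate (coord y k))"
      using that assms by (simp add: mean_mat_def scaleR_conv_of_real sum_distrib_right)
    then show ?thesis by (metis re_scale re_sum)
  qed
  then have "real n * form m (mean_mat m n A) y
      = (\<Sum>k<m. \<Sum>l<m. \<Sum>i=1..n. re (A i $$ (k, l) * coord y l * conjugate (coord y k)))"
    by (simp add: form_def sum_distrib_left)
  also have "\<dots> = (\<Sum>k<m. \<Sum>i=1..n. \<Sum>l<m. re (A i $$ (k, l) * coord y l * conjugate (coord y k)))"
    by (intro sum.cong refl sum.swap)
  also have "\<dots> = (\<Sum>i=1..n. form m (A i) y)"
    unfolding form_def by (rule sum.swap)
  finally show ?thesis ..
qed

text \<open>The event about the smallest singular value is contained in the event \<open>F\<close> of \<open>uniform_lower_tail\<close>: a unit vector from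
\<open>unit_vector_sigma_val\<close> has small form on the mean matrix.\<close>

theorem tail_bound_over_scalars: "tail_bound_over TYPE('w) TYPE('a) 10000"
  unfolding tail_bound_over_def
proof (intro allI impI)
  fix P :: "'w measure" and m n and M :: "nat \<Rightarrow> 'w \<Rightarrow> 'a mat" and \<alpha> \<beta> :: real
  assume P: "prob_space P" and m: "0 < m" and n: "0 < n"
    and ind: "prob_space.indep_vars P (\<lambda>_. borel_mat m) M {1..n}"
    and psd: "\<forall>i\<in>{1..n}. \<forall>\<omega>\<in>space P. psd_mat m (M i \<omega>)"
    and \<alpha>: "0 \<le> \<alpha>" and \<beta>: "0 < \<beta>" "\<beta> \<le> 1"
    and tail: "\<forall>x\<in>carrier_vec m. x \<bullet>c x = 1 \<longrightarrow>
        real n * \<beta> \<le> (\<Sum>i = 1..n. measure P {\<omega> \<in> space P. of_real \<alpha> < (M i \<omega> *\<^sub>v x) \<bullet>c x})"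
    and large: "10000 * real m / \<beta> * ln (2 / \<beta>) \<le> real n"
  interpret P: prob_space P by fact
  have Mc: "M i \<omega> \<in> carrier_mat m m" if "i \<in> {1..n}" "\<omega> \<in> space P" for i \<omega>
    using psd that by (auto simp: psd_mat_def)
  have tail': "real n * \<beta> \<le> (\<Sum>i=1..n. measure P {\<omega> \<in> space P. form m (M i \<omega>) y > \<alpha>})"
    if y: "y \<in> coord_space (r * m)" "coord_norm (r * m) y = 1" for y
  proof -
    define x where "x = vec m (coord y)"
    have x: "x \<in> carrier_vec m" "x \<bullet>c x = 1" using y by (simp_all add: x_def vec_norm)
    have "of_real \<alpha> < (M i \<omega> *\<^sub>v x) \<bullet>c x \<longleftrightarrow> form m (M i \<omega>) y > \<alpha>"
      if i: "i \<in> {1..n}" "\<omega> \<in> space P" for i \<omega>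
    proof -
      have "0 \<le> (M i \<omega> *\<^sub>v x) \<bullet>c x" using psd i x(1) by (auto simp: psd_mat_def)
      then have "(M i \<omega> *\<^sub>v x) \<bullet>c x = of_real (re ((M i \<omega> *\<^sub>v x) \<bullet>c x))" using nonneg_real by blast
      also have "\<dots> = of_real (form m (M i \<omega>) y)" using Mc[OF i] by (simp add: form_eq x_def)
      finally show ?thesis using of_real_less by simp
    qed
    then have "{\<omega> \<in> space P. of_real \<alpha> < (M i \<omega> *\<^sub>v x) \<bullet>c x} = {\<omega> \<in> space P. form m (M i \<omega>) y > \<alpha>}"
      if "i \<in> {1..n}" for i using that by blast
    then have "(\<Sum>i=1..n. measure P {\<omega> \<in> space P. of_real \<alpha> < (M i \<omega> *\<^sub>v x) \<bullet>c x})
        = (\<Sum>i=1..n. measure P {\<omega> \<in> space P. form m (M i \<omega>) y > \<alpha>})"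
      by (intro sum.cong refl) simp
    moreover have "real n * \<beta> \<le> (\<Sum>i=1..n. measure P {\<omega> \<in> space P. of_real \<alpha> < (M i \<omega> *\<^sub>v x) \<bullet>c x})"
      using tail x by blast
    ultimately show ?thesis by simp
  qed
  have rm: "0 < r * m" "r * m \<le> 2 * m" using r m by auto
  obtain F where F: "F \<in> sets P" "measure P F \<le> exp (- (real n * \<beta> / 10000))"
    "\<And>\<omega> w. \<omega> \<in> space P \<Longrightarrow> w \<in> coord_space (r * m) \<Longrightarrow> coord_norm (r * m) w = 1 \<Longrightarrow>
       (\<Sum>i=1..n. form m (M i \<omega>) w) \<le> real n * \<alpha> * \<beta> / 2 \<Longrightarrow> \<omega> \<in> F"
    using psd.uniform_lower_tail[OF P indep_vars_psd_space[OF P ind psd] n m rm \<alpha> \<beta> tail' large]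
    by blast
  let ?S = "\<lambda>\<omega>. mean_mat m n (\<lambda>i. M i \<omega>)"
  have sub: "{\<omega> \<in> space P. sigma_val m (?S \<omega>) \<le> \<alpha> * \<beta> / 2} \<subseteq> F"
  proof clarify
    fix \<omega> assume \<omega>: "\<omega> \<in> space P" and le: "sigma_val m (?S \<omega>) \<le> \<alpha> * \<beta> / 2"
    have S: "?S \<omega> \<in> carrier_mat m m" by (simp add: mean_mat_def)
    obtain x where x: "x \<in> carrier_vec m" "x \<bullet>c x = 1" "re ((?S \<omega> *\<^sub>v x) \<bullet>c x) \<le> sigma_val m (?S \<omega>)"
      using unit_vector_sigma_val[OF S m] .
    obtain y where y: "y \<in> coord_space (r * m)" "\<forall>k<m. coord y k = x $ k"
      using coord_surj[of m "\<lambda>k. x $ k"] by blast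
    have xy: "vec m (coord y) = x" using x(1) y(2) by (intro eq_vecI) auto
    have "of_real ((coord_norm (r * m) y)\<^sup>2) = (of_real 1 :: 'a)"
      using vec_norm[of m y] x(2) by (simp add: xy)
    then have "(coord_norm (r * m) y)\<^sup>2 = 1" by (simp only: of_real_eq_iff)
    then have ny: "coord_norm (r * m) y = 1"
      using L2_set_nonneg[of y "{..<r * m}"] by (simp add: power2_eq_1_iff)
    have "(\<Sum>i=1..n. form m (M i \<omega>) y) = real n * re ((?S \<omega> *\<^sub>v x) \<bullet>c x)"
      unfolding form_mean_mat[OF n] form_eq[OF S] xy ..
    also have "\<dots> \<le> real n * (\<alpha> * \<beta> / 2)" using x(3) le by (intro mult_left_mono) auto
    finally show "\<omega> \<in> F" by (intro F(3)[OF \<omega> y(1) ny]) (simp add: mult.assoc)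
  qed
  show "measure P {\<omega> \<in> space P. sigma_val m (?S \<omega>) \<le> \<alpha> * \<beta> / 2} \<le> exp (- (real n * \<beta> / 10000))"
    using P.finite_measure_mono[OF sub F(1)] F(2) by linarith
qed

end

section \<open>The real and the complex numbers\<close>

lemma cscalar_self_complex: "v \<bullet>c v = of_real (\<Sum>k<dim_vec v. (cmod (v $ k))\<^sup>2)" for v :: "complex vec"
proof -
  have "v \<bullet>c v = (\<Sum>k<dim_vec v. v $ k * cnj (v $ k))"
    by (simp add: scalar_prod_def atLeast0LessThan)
  then show ?thesis by (simp only: complex_norm_square[symmetric] of_real_sum)
qed

lemma size_proots_char_poly_complex:
  fixes A :: "complex mat"
  assumes "A \<in> carrier_mat m m"
  shows "size (proots (char_poly A)) = m"
  using degree_monic_char_poly[OF assms] by (simp add: size_proots_complex)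

text \<open>Real and imaginary parts alternate, so that the first \<open>2 * m\<close> real coordinates describe the first \<open>m\<close> complex ones.\<close>

definition complex_coord :: "(nat \<Rightarrow> real) \<Rightarrow> nat \<Rightarrow> complex" where
  "complex_coord y k = Complex (y (2 * k)) (y (2 * k + 1))"

interpretation complex_scalars: scalar_coords Re complex_coord 2
proof (rule scalar_coords.intro)
  show "bounded_linear Re" by (rule bounded_linear_Re)
  show "Re z \<le> cmod z" for z by (rule complex_Re_le_cmod)
  show "z = of_real (Re z) \<and> 0 \<le> Re z" if "0 \<le> z" for z
    using that by (auto simp: less_eq_complex_def complex_eq_iff)
  show "(of_real s < (of_real t :: complex)) = (s < t)" for s t
    by (simp add: less_complex_def)
  show "bounded_linear (conjugate :: complex \<Rightarrow> complex)"
    by (simp add: bounded_linear_cnj)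
  show "z * conjugate z = of_real ((cmod z)\<^sup>2)" for z
    using complex_norm_square[of z] by simp
  show "complex_coord (s *\<^sub>R x + t *\<^sub>R y) k = s *\<^sub>R complex_coord x k + t *\<^sub>R complex_coord y k" for s x t y k
    by (simp add: complex_coord_def complex_eq_iff)
  show "continuous_on UNIV (\<lambda>y. complex_coord y k)" for k
    by (simp add: complex_coord_def Complex_eq) (intro continuous_intros; simp)
  show "(\<Sum>k<m. (cmod (complex_coord y k))\<^sup>2) = (\<Sum>i<2 * m. (y i)\<^sup>2)" for y m
    by (induction m) (simp_all add: complex_coord_def cmod_power2)
  show "\<exists>y\<in>coord_space (2 * m). \<forall>k<m. complex_coord y k = v k" for m v
    by (rule bexI[of _ "\<lambda>i. if i < 2 * m then (if even i then Re (v (i div 2)) else Im (v (i div 2))) else 0"])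
      (auto simp: complex_coord_def coord_space_def complex_eq_iff)
  show "size (proots (char_poly (mat_adjoint A * A))) = m" if "A \<in> carrier_mat m m" for A :: "complex mat" and m
    using that by (intro size_proots_char_poly_complex mult_carrier_mat[of _ m m])
      (auto intro!: carrier_matI simp: mat_adjoint_def)
qed simp_all

lemma proots_linear_factors: "proots (\<Prod>a\<leftarrow>as. [:- a, 1:]) = mset as" for as :: "'a::field list"
proof (induction as)
  case (Cons a as)
  have "proots ([:- a, 1:] * (\<Prod>a\<leftarrow>as. [:- a, 1:])) = proots [:- a, 1:] + proots (\<Prod>a\<leftarrow>as. [:- a, 1:])"
    by (rule proots_mult) (auto simp: prod_list_zero_iff)
  then show ?case using Cons by simp
qed simp

text \<open>Over the complex numbers the characteristic polynomial splits. Its roots are real: if \<open>v\<close> is an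
eigenvector of \<open>C\<^sup>* C\<close> for \<open>a\<close>, then \<open>a * |v|\<^sup>2 = |C v|\<^sup>2\<close>. Hence it splits over the real numbers already.\<close>

lemma size_proots_char_poly_gram_real:
  fixes A :: "real mat"
  assumes A: "A \<in> carrier_mat m m"
  shows "size (proots (char_poly (mat_adjoint A * A))) = m"
proof -
  define B where "B = mat_adjoint A * A"
  define C where "C = map_mat complex_of_real A"
  have Aa: "mat_adjoint A \<in> carrier_mat m m" using A by (auto intro!: carrier_matI simp: mat_adjoint_def)
  have B: "B \<in> carrier_mat m m" unfolding B_def by (rule mult_carrier_mat[OF Aa A])
  have C: "C \<in> carrier_mat m m" using A by (simp add: C_def)
  have adj: "map_mat complex_of_real (mat_adjoint A) = mat_adjoint C"
    using A by (intro eq_matI) (auto simp: C_def mat_adjoint_def mat_of_rows_index)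
  have CB: "map_mat complex_of_real B = mat_adjoint C * C"
    by (simp only: B_def of_real_hom.mat_hom_mult[OF Aa A] adj C_def[symmetric])
  have cB: "map_mat complex_of_real B \<in> carrier_mat m m" using B by simp
  obtain as where as: "char_poly (map_mat complex_of_real B) = (\<Prod>a\<leftarrow>as. [:- a, 1:])" "length as = m"
    using char_poly_factorized[OF cB] by auto
  have real: "a = of_real (Re a)" if "a \<in> set as" for a
  proof -
    have "poly (char_poly (map_mat complex_of_real B)) a = 0"
      unfolding as poly_prod_list using that by (auto simp: prod_list_zero_iff)
    then have "eigenvalue (map_mat complex_of_real B) a" using eigenvalue_root_char_poly[OF cB] by simp
    then obtain v where v: "v \<in> carrier_vec m" "v \<noteq> 0\<^sub>v m" "(mat_adjoint C * C) *\<^sub>v v = a \<cdot>\<^sub>v v"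
      unfolding eigenvalue_def eigenvector_def CB[symmetric] using B by auto
    have "a * (v \<bullet>c v) = (C *\<^sub>v v) \<bullet>c (C *\<^sub>v v)"
      using complex_scalars.adjoint_cscalar[OF C v(1)] v by simp
    moreover have "v \<bullet>c v \<noteq> 0" using v(2) conjugate_square_eq_0_vec[OF v(1)] by simp
    ultimately have "a = ((C *\<^sub>v v) \<bullet>c (C *\<^sub>v v)) / (v \<bullet>c v)" by (simp add: field_simps)
    then show ?thesis unfolding cscalar_self_complex by (metis Re_complex_of_real of_real_divide)
  qed
  have "map_poly complex_of_real (char_poly B) = char_poly (map_mat complex_of_real B)"
    by (rule of_real_hom.char_poly_hom[OF B, symmetric])
  also have "\<dots> = (\<Prod>a\<leftarrow>as. [:- of_real (Re a), 1:])"
    unfolding as using real by (intro arg_cong[of _ _ prod_list] map_cong) auto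
  also have "\<dots> = map_poly complex_of_real (\<Prod>a\<leftarrow>map Re as. [:- a, 1:])"
  proof -
    interpret mp: map_poly_inj_comm_ring_hom complex_of_real ..
    show ?thesis by (simp add: mp.hom_prod_list comp_def)
  qed
  finally have "char_poly B = (\<Prod>a\<leftarrow>map Re as. [:- a, 1:])"
  proof -
    interpret mp: map_poly_inj_comm_ring_hom complex_of_real ..
    show ?thesis if "map_poly complex_of_real (char_poly B) = map_poly complex_of_real (\<Prod>a\<leftarrow>map Re as. [:- a, 1:])"
      using that by simp
  qed
  then show ?thesis unfolding B_def[symmetric] by (simp only: proots_linear_factors size_mset length_map as)
qed

interpretation real_scalars: scalar_coords "\<lambda>x::real. x" "\<lambda>y k. y k" 1
proof (rule scalar_coords.intro)
  show "bounded_linear (\<lambda>x::real. x)" by (rule bounded_linear_ident)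
  have conj: "(conjugate :: real \<Rightarrow> real) = (\<lambda>x. x)" by (simp add: fun_eq_iff)
  show "bounded_linear (conjugate :: real \<Rightarrow> real)" unfolding conj by (rule bounded_linear_ident)
  show "\<exists>y\<in>coord_space (1 * m). \<forall>k<m. y k = v k" for m and v :: "nat \<Rightarrow> real"
    by (rule bexI[of _ "\<lambda>i. if i < m then v i else 0"]) (auto simp: coord_space_def)
  show "size (proots (char_poly (mat_adjoint A * A))) = m" if "A \<in> carrier_mat m m" for A :: "real mat" and m
    by (rule size_proots_char_poly_gram_real[OF that])
qed (auto simp: power2_eq_square)

section \<open>Change of the sample space\<close>

text \<open>The largest \<open>\<sigma>\<close>-algebra on the image that makes \<open>f\<close> measurable. With this choice a set is measurable exactly if
its preimage is, so the push-forward measure agrees with the original measure of the preimage on all subsets of the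
image, including those where both are \<open>0\<close> for lack of measurability.\<close>

definition final_algebra :: "'w measure \<Rightarrow> ('w \<Rightarrow> 'v) \<Rightarrow> 'v measure" where
  "final_algebra P f = sigma (f ` space P) {B. B \<subseteq> f ` space P \<and> f -` B \<inter> space P \<in> sets P}"

lemma space_final_algebra: "space (final_algebra P f) = f ` space P"
  unfolding final_algebra_def by (intro space_measure_of) auto

lemma sets_final_algebra:
  "sets (final_algebra P f) = {B. B \<subseteq> f ` space P \<and> f -` B \<inter> space P \<in> sets P}"
proof -
  let ?S = "{B. B \<subseteq> f ` space P \<and> f -` B \<inter> space P \<in> sets P}"
  have "sigma_algebra (f ` space P) ?S"
    unfolding sigma_algebra_iff2
  proof (intro conjI ballI allI impI)
    fix B assume "B \<in> ?S"
    moreover have "f -` (f ` space P - B) \<inter> space P = space P - (f -` B \<inter> space P)" by auto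
    ultimately show "f ` space P - B \<in> ?S" by auto
  next
    fix A assume A: "range (A :: nat \<Rightarrow> _) \<subseteq> ?S"
    have "f -` (\<Union>i. A i) \<inter> space P = (\<Union>i. f -` A i \<inter> space P)" by auto
    also have "\<dots> \<in> sets P" using A by (intro sets.countable_UN) auto
    finally show "(\<Union>i. A i) \<in> ?S" using A by auto
  qed auto
  then show ?thesis
    unfolding final_algebra_def by (subst sets_measure_of) (auto simp: sigma_algebra.sigma_sets_eq)
qed

lemma measurable_final_algebra: "f \<in> measurable P (final_algebra P f)"
  by (rule measurableI) (auto simp: space_final_algebra sets_final_algebra)

lemma measure_distr_final_algebra:
  assumes "B \<subseteq> f ` space P"
  shows "measure (distr P (final_algebra P f) f) B = measure P (f -` B \<inter> space P)"
proof (cases "f -` B \<inter> space P \<in> sets P")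
  case True
  then have "B \<in> sets (final_algebra P f)" using assms by (simp add: sets_final_algebra)
  then show ?thesis by (rule measure_distr[OF measurable_final_algebra])
next
  case False
  then have "B \<notin> sets (distr P (final_algebra P f) f)" by (simp add: sets_final_algebra)
  then show ?thesis using False by (simp add: measure_notin_sets)
qed

text \<open>The sequence \<open>f \<omega>\<close> of the encoded matrices is the new sample point. It determines the matrices since \<open>R\<close> decodes them,
so every event about the matrices is a preimage under \<open>f\<close>, and their joint law does not change.\<close>

lemma tail_bound_over_pullback:
  fixes E :: "'a::{conjugatable_ordered_field, real_normed_field} mat \<Rightarrow> 'b" and c :: real
  assumes RE: "\<And>A. R (E A) = A" and tb: "tail_bound_over TYPE(nat \<Rightarrow> 'b) TYPE('a) c"
  shows "tail_bound_over TYPE('w) TYPE('a) c"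
  unfolding tail_bound_over_def
proof (intro allI impI)
  fix P :: "'w measure" and m n and M :: "nat \<Rightarrow> 'w \<Rightarrow> 'a mat" and \<alpha> \<beta> :: real
  assume P: "prob_space P" and mn: "0 < m" "0 < n"
    and ind: "prob_space.indep_vars P (\<lambda>_. borel_mat m) M {1..n}"
    and psd: "\<forall>i\<in>{1..n}. \<forall>\<omega>\<in>space P. psd_mat m (M i \<omega>)"
    and ab: "0 \<le> \<alpha>" "0 < \<beta>" "\<beta> \<le> 1"
    and tail: "\<forall>x\<in>carrier_vec m. x \<bullet>c x = 1 \<longrightarrow>
        real n * \<beta> \<le> (\<Sum>i = 1..n. measure P {\<omega> \<in> space P. of_real \<alpha> < (M i \<omega> *\<^sub>v x) \<bullet>c x})"
    and large: "c * real m / \<beta> * ln (2 / \<beta>) \<le> real n"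
  interpret P: prob_space P by fact
  define f where "f \<omega> = (\<lambda>i. E (M i \<omega>))" for \<omega>
  define M' where "M' i \<eta> = R (\<eta> i)" for i and \<eta> :: "nat \<Rightarrow> 'b"
  define P' where "P' = distr P (final_algebra P f) f"
  have M'f: "M' i (f \<omega>) = M i \<omega>" for i \<omega> by (simp add: M'_def f_def RE)
  have f: "f \<in> measurable P (final_algebra P f)" by (rule measurable_final_algebra)
  have sp: "space P' = f ` space P" by (simp add: P'_def space_final_algebra)
  have P': "prob_space P'" unfolding P'_def by (rule P.prob_space_distr[OF f])
  interpret P': prob_space P' by fact
  have meas: "measure P' {\<eta> \<in> space P'. \<phi> (\<lambda>i. M' i \<eta>)} = measure P {\<omega> \<in> space P. \<phi> (\<lambda>i. M i \<omega>)}"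
    for \<phi> :: "(nat \<Rightarrow> 'a mat) \<Rightarrow> bool"
  proof -
    have "measure P' {\<eta> \<in> space P'. \<phi> (\<lambda>i. M' i \<eta>)} = measure P (f -` {\<eta> \<in> space P'. \<phi> (\<lambda>i. M' i \<eta>)} \<inter> space P)"
      unfolding P'_def by (rule measure_distr_final_algebra) (auto simp: space_final_algebra)
    also have "f -` {\<eta> \<in> space P'. \<phi> (\<lambda>i. M' i \<eta>)} \<inter> space P = {\<omega> \<in> space P. \<phi> (\<lambda>i. M' i (f \<omega>))}"
      unfolding sp by blast
    also have "\<dots> = {\<omega> \<in> space P. \<phi> (\<lambda>i. M i \<omega>)}" by (simp only: M'f)
    finally show ?thesis .
  qed
  have M: "M i \<in> measurable P (borel_mat m)" if "i \<in> {1..n}" for i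
    using ind that unfolding P.indep_vars_def by auto
  have M': "M' i \<in> measurable (final_algebra P f) (borel_mat m)" if i: "i \<in> {1..n}" for i
  proof (rule measurableI)
    fix \<eta> assume "\<eta> \<in> space (final_algebra P f)"
    then show "M' i \<eta> \<in> space (borel_mat m)"
      using measurable_space[OF M[OF i]] by (auto simp: space_final_algebra M'f)
  next
    fix B :: "'a mat set" assume B: "B \<in> sets (borel_mat m)"
    have "f -` (M' i -` B \<inter> f ` space P) \<inter> space P = {\<omega> \<in> space P. M' i (f \<omega>) \<in> B}"
      by blast
    also have "\<dots> = M i -` B \<inter> space P" by (auto simp: M'f)
    also have "\<dots> \<in> sets P" by (rule measurable_sets[OF M[OF i] B])
    finally show "M' i -` B \<inter> space (final_algebra P f) \<in> sets (final_algebra P f)"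
      by (simp add: sets_final_algebra space_final_algebra)
  qed
  have ne: "{1..n} \<noteq> {}" using mn by auto
  have M'P: "M' i \<in> measurable P' (borel_mat m)" if "i \<in> {1..n}" for i
    using M'[OF that] by (simp add: P'_def)
  have di: "distr P' (borel_mat m) (M' i) = distr P (borel_mat m) (M i)" if "i \<in> {1..n}" for i
    unfolding P'_def distr_distr[OF M'[OF that] f] by (simp add: comp_def M'f)
  have ind': "prob_space.indep_vars P' (\<lambda>_. borel_mat m) M' {1..n}"
  proof -
    have "distr P' (Pi\<^sub>M {1..n} (\<lambda>_. borel_mat m)) (\<lambda>\<eta>. \<lambda>i\<in>{1..n}. M' i \<eta>)
        = distr P (Pi\<^sub>M {1..n} (\<lambda>_. borel_mat m)) ((\<lambda>\<eta>. \<lambda>i\<in>{1..n}. M' i \<eta>) \<circ> f)"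
      unfolding P'_def by (intro distr_distr f measurable_restrict M')
    also have "\<dots> = distr P (Pi\<^sub>M {1..n} (\<lambda>_. borel_mat m)) (\<lambda>\<omega>. \<lambda>i\<in>{1..n}. M i \<omega>)"
      by (simp add: comp_def M'f)
    also have "\<dots> = Pi\<^sub>M {1..n} (\<lambda>i. distr P (borel_mat m) (M i))"
      using P.indep_vars_iff_distr_eq_PiM'[where I = "{1..n}" and M' = "\<lambda>_. borel_mat m" and X = M, OF ne M] ind
      by simp
    also have "\<dots> = Pi\<^sub>M {1..n} (\<lambda>i. distr P' (borel_mat m) (M' i))"
      by (intro PiM_cong) (simp_all add: di)
    finally show ?thesis
      using P'.indep_vars_iff_distr_eq_PiM'[where I = "{1..n}" and M' = "\<lambda>_. borel_mat m" and X = M', OF ne M'P]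
      by simp
  qed
  have psd': "\<forall>i\<in>{1..n}. \<forall>\<eta>\<in>space P'. psd_mat m (M' i \<eta>)"
    using psd by (auto simp: sp M'f)
  have tail': "\<forall>x\<in>carrier_vec m. x \<bullet>c x = 1 \<longrightarrow>
        real n * \<beta> \<le> (\<Sum>i = 1..n. measure P' {\<eta> \<in> space P'. of_real \<alpha> < (M' i \<eta> *\<^sub>v x) \<bullet>c x})"
    using tail by (simp only: meas[of "\<lambda>A. of_real \<alpha> < (A i *\<^sub>v x) \<bullet>c x" for i x])
  have "measure P' {\<eta> \<in> space P'. sigma_val m (mean_mat m n (\<lambda>i. M' i \<eta>)) \<le> \<alpha> * \<beta> / 2} \<le> exp (- (real n * \<beta> / c))"
    using tb P' mn ind' psd' ab tail' large unfolding tail_bound_over_def by blast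
  then show "measure P {\<omega> \<in> space P. sigma_val m (mean_mat m n (\<lambda>i. M i \<omega>)) \<le> \<alpha> * \<beta> / 2} \<le> exp (- (real n * \<beta> / c))"
    using meas[of "\<lambda>A. sigma_val m (mean_mat m n A) \<le> \<alpha> * \<beta> / 2"] by simp
qed

lemma tail_bound_from_canonical:
  assumes "tail_bound canonical_sample c"
  shows "tail_bound TYPE('w) c"
proof -
  have "map_mat Re (map_mat complex_of_real A) = A" for A
    by (rule eq_matI) auto
  then show ?thesis
    using assms tail_bound_over_pullback[where E = "map_mat complex_of_real" and R = "map_mat Re" and 'a = real]
      tail_bound_over_pullback[where E = "\<lambda>A::complex mat. A" and R = "\<lambda>A. A"]
    unfolding tail_bound_def by blast
qed

theorem theorem1p1:
  shows "(\<exists>c>0. tail_bound canonical_sample c) \<and>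
         (\<forall>c>0. tail_bound canonical_sample c \<longrightarrow> tail_bound TYPE('w) c)"
proof
  have "tail_bound canonical_sample 10000"
    unfolding tail_bound_def
    using real_scalars.tail_bound_over_scalars complex_scalars.tail_bound_over_scalars by blast
  then show "\<exists>c>0. tail_bound canonical_sample c" by (intro exI[of _ 10000]) simp
  show "\<forall>c>0. tail_bound canonical_sample c \<longrightarrow> tail_bound TYPE('w) c"
    using tail_bound_from_canonical by blast
qed

end
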